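(* Let $k\ge 2$ be an integer and $\delta>0$ a constant. Builder has a $\left(\tau_k, (k/2 + 2^{-k} + \delta)n\right)$-strategy that with high probability yields a graph with minimum degree at least $k$.
   Context: Let $V=[n]$, $N=\binom{n}{2}$, and let $e_1,\dots,e_N$ be a uniformly random permutation of the edges of the complete graph $K_n$ on $V$; $\mathbf{G}_{n,m}$ denotes the graph on $V$ with edge set $\{e_1,\dots,e_m\}$ (the random graph process). A player, Builder, sees the edges $e_1,e_2,\dots$ one by one and must decide irrevocably upon seeing $e_i$ whether to purchase it; her graph $B_i$ consists of the edges purchased among $e_1,\dots,e_i$. A $(t,b)$-strategy is an online algorithm (deterministic or randomised) that Builder follows in this model where she sees only the first $t$ edges of the permutation and purchases at most $b$ of them; the strategy yields the graph $B_t$. Here $\tau_k=\min\{m: \delta(\mathbf{G}_{n,m})\ge k\}$ is the hitting time for minimum degree at least $k$. "With high probability" means with probability tending to $1$ as $n\to\infty$. *)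

theory Defs
  imports "HOL-Probability.Probability" "HOL-Combinatorics.Multiset_Permutations"
begin

text \<open>A graph on the vertex set \<open>{1..n}\<close> is represented by its set of edges, an edge being
  a two-element set of vertices.\<close>

type_synonym edge = "nat set"

definition complete_edges :: "nat \<Rightarrow> edge set" where
  "complete_edges n = {e. e \<subseteq> {1..n} \<and> card e = 2}"

definition vertex_degree :: "edge set \<Rightarrow> nat \<Rightarrow> nat" where
  "vertex_degree E v = card {e \<in> E. v \<in> e}"

text \<open>Only meaningful for \<open>n \<ge> 1\<close>, as the graph without vertices has no minimum degree.\<close>

definition min_degree :: "nat \<Rightarrow> edge set \<Rightarrow> nat" where
  "min_degree n E = Min (vertex_degree E ` {1..n})"

definition edge_process :: "nat \<Rightarrow> edge list pmf" where
  "edge_process n = pmf_of_set (permutations_of_set (complete_edges n))"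

definition process_graph :: "edge list \<Rightarrow> nat \<Rightarrow> edge set" where
  "process_graph es m = set (take m es)"

text \<open>If \<open>n \<le> k\<close> (and \<open>n \<ge> 1\<close>), minimum degree \<open>k\<close> is never reached; the infimum of the
  empty set of natural numbers is then \<open>0\<close>.\<close>

definition hitting_time :: "nat \<Rightarrow> nat \<Rightarrow> edge list \<Rightarrow> nat" where
  "hitting_time n k es = Inf {m. k \<le> min_degree n (process_graph es m)}"

text \<open>A deterministic online rule decides whether to purchase the current edge, the last entry
  of the list of all edges seen so far. Its own past decisions are determined by that list.
  A randomised algorithm is a probability distribution on deterministic rules, sampled
  independently of the edge process; the deterministic algorithms are the point masses. Discrete
  distributions suffice because, for each \<open>n\<close>, only finitely many histories can occur.\<close>

type_synonym online_rule = "edge list \<Rightarrow> bool"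
type_synonym strategy = "online_rule pmf"

definition builder_graph :: "online_rule \<Rightarrow> edge list \<Rightarrow> nat \<Rightarrow> edge set" where
  "builder_graph \<sigma> es i = {es ! j |j. j < i \<and> j < length es \<and> \<sigma> (take (Suc j) es)}"

text \<open>The time horizon \<open>t\<close> may depend on the edge process. The budget \<open>b\<close> is a hard constraint:
  it holds for every edge order and every outcome of Builder's own randomness.\<close>

definition is_strategy :: "nat \<Rightarrow> (edge list \<Rightarrow> nat) \<Rightarrow> real \<Rightarrow> strategy \<Rightarrow> bool" where
  "is_strategy n t b S \<longleftrightarrow>
     (\<forall>\<sigma>\<in>set_pmf S. \<forall>es\<in>permutations_of_set (complete_edges n).
        real (card (builder_graph \<sigma> es (t es))) \<le> b)"

text \<open>The random graph \<open>B\<^sub>t\<close> obtained by following \<open>S\<close>.\<close>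

definition yielded_graph :: "nat \<Rightarrow> (edge list \<Rightarrow> nat) \<Rightarrow> strategy \<Rightarrow> edge set pmf" where
  "yielded_graph n t S =
     map_pmf (\<lambda>(\<sigma>, es). builder_graph \<sigma> es (t es)) (pair_pmf S (edge_process n))"

end

theory Submission imports Defs "HOL-Real_Asymp.Real_Asymp" begin

text \<open>Builder works in two phases. During the first \<open>T = n ln ln n / 8\<close> edges she buys an edge if both ends
  have degree less than \<open>k\<close> in her graph, or if some end has degree \<open>0\<close>; afterwards she buys an edge if some
  end has degree less than \<open>k\<close>.

  Every vertex touched in the first phase owns an edge, so it only needs \<open>k - 1\<close> further edges after
  time \<open>T\<close>. A second moment argument shows that \<open>\<tau>\<^sub>k\<close> exceeds \<open>n (ln n + (k - 3 / 2) ln ln n) / 2\<close>, and a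
  first moment argument that by then every vertex has received these edges. Untouched vertices have all
  their edges after time \<open>T\<close>.

  As for the cost, edges joining two unsaturated vertices number at most \<open>k n / 2\<close>. The first phase
  leaves few deficient vertices, because the random graph has no large sparse vertex set. The remaining
  edges are \<open>late\<close>: they join an isolated vertex to one of degree at least \<open>k\<close> in the random graph. If
  \<open>I\<close> counts the isolated vertices and \<open>d\<^sub>v\<close> is the current degree of \<open>v\<close>, then the number of late edges plus
  \<open>I (\<Sum>\<^sub>v 2 powr - max 0 (k - d\<^sub>v)) / (n - 1)\<close> is a supermartingale with bounded increments, started at
  about \<open>n / 2 ^ k\<close>.\<close>

section \<open>Averages over random permutations\<close>

text \<open>The last vertices to reach degree \<open>k\<close> decide the hitting time, and Builder
  can afford to lose hardly any of their edges. Asking every vertex for \<open>k\<close> edges after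
  time T would leave an expected number of failures that grows with n. Asking for one edge less
  saves a factor of order \<open>ln n\<close>, more than the late start costs. This is why every
  edge at a vertex of degree 0 is accepted early.

  The price of that clause is a race. Let v be the partner in the first edge of u. Edges at u and
  edges at v arrive equally fast, so v collects \<open>k\<close> edges before u gets any with
  probability about 2^-k. Hence there are about n / 2^k late edges. The potential encodes this race,
  which avoids following the whole degree sequence.

  Two requirements fix the order of T: it must be superlinear in n, to beat the exponential number
  of vertex sets, and at most a small multiple of n ln ln n, to leave enough edges for later.

  The budget must hold for every edge order, not just for typical ones, so the rule is also cut off
  once its cost would exceed the budget.\<close>

definition perm_avg :: "'a set \<Rightarrow> ('a list \<Rightarrow> real) \<Rightarrow> real" where
  "perm_avg A f = (\<Sum>es\<in>permutations_of_set A. f es) / fact (card A)"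

lemma perm_avg_mono:
  assumes "\<And>es. es \<in> permutations_of_set A \<Longrightarrow> f es \<le> g es"
  shows "perm_avg A f \<le> perm_avg A g"
  unfolding perm_avg_def by (intro divide_right_mono sum_mono assms) auto

lemma perm_avg_cong:
  assumes "\<And>es. es \<in> permutations_of_set A \<Longrightarrow> f es = g es"
  shows "perm_avg A f = perm_avg A g"
  unfolding perm_avg_def using assms by (simp cong: sum.cong)

lemma perm_avg_add: "perm_avg A (\<lambda>es. f es + g es) = perm_avg A f + perm_avg A g"
  by (simp add: perm_avg_def sum.distrib add_divide_distrib)

lemma perm_avg_diff: "perm_avg A (\<lambda>es. f es - g es) = perm_avg A f - perm_avg A g"
  by (simp add: perm_avg_def sum_subtractf diff_divide_distrib)

lemma perm_avg_cmult: "perm_avg A (\<lambda>es. c * f es) = c * perm_avg A f"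
  by (simp add: perm_avg_def sum_distrib_left)

lemma perm_avg_sum: "perm_avg A (\<lambda>es. \<Sum>i\<in>I. f i es) = (\<Sum>i\<in>I. perm_avg A (f i))"
  unfolding perm_avg_def by (subst sum.swap) (simp add: sum_divide_distrib)

lemma perm_avg_const: "finite A \<Longrightarrow> perm_avg A (\<lambda>_. c) = c"
  by (simp add: perm_avg_def)

lemma perm_avg_Cons:
  assumes "finite A" "A \<noteq> {}"
  shows "perm_avg A f = (\<Sum>x\<in>A. perm_avg (A - {x}) (\<lambda>es. f (x # es))) / card A"
proof -
  have "(\<Sum>es\<in>permutations_of_set A. f es)
      = (\<Sum>x\<in>A. \<Sum>es\<in>(#) x ` permutations_of_set (A - {x}). f es)"
    unfolding permutations_of_set_nonempty[OF assms(2)]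
    by (subst sum.UNION_disjoint) (use assms in auto)
  also have "\<dots> = (\<Sum>x\<in>A. \<Sum>es\<in>permutations_of_set (A - {x}). f (x # es))"
    by (rule sum.cong[OF refl]) (simp add: sum.reindex)
  finally show ?thesis
    using assms card_gt_0_iff[of A]
    by (simp add: perm_avg_def sum_divide_distrib fact_reduce[of "card A"] mult.commute)
qed

text \<open>Given the first \<open>t\<close> entries, the next one is uniform on the rest. This
  replaces conditional expectation throughout. The induction peels off the first entry of the
  permutation, so \<open>A\<close> and \<open>f\<close> must vary.\<close>

lemma perm_avg_prefix_Suc:
  assumes "finite A" "t < card A"
  shows "perm_avg A (\<lambda>es. f (take (Suc t) es)) =
    perm_avg A (\<lambda>es. (\<Sum>x\<in>A - set (take t es). f (take t es @ [x])) / (card A - t))"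
  using assms
proof (induction t arbitrary: A f)
  case 0
  then have "A \<noteq> {}" by auto
  have "perm_avg A (\<lambda>es. f (take (Suc 0) es)) = (\<Sum>x\<in>A. f [x]) / card A"
    using 0 by (subst perm_avg_Cons[OF 0(1) \<open>A \<noteq> {}\<close>]) (simp add: perm_avg_const)
  then show ?case using 0 by (simp add: perm_avg_const)
next
  case (Suc t)
  then have ne: "A \<noteq> {}" by auto
  have "perm_avg A (\<lambda>es. f (take (Suc (Suc t)) es))
      = (\<Sum>x\<in>A. perm_avg (A - {x}) (\<lambda>es. f (x # take (Suc t) es))) / card A"
    by (subst perm_avg_Cons[OF Suc(2) ne]) simp
  also have "\<dots> = (\<Sum>x\<in>A. perm_avg (A - {x}) (\<lambda>es.
       (\<Sum>y\<in>(A - {x}) - set (take t es). f (x # take t es @ [y])) / (card (A - {x}) - t))) / card A"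
    using Suc.prems by (intro arg_cong2[of _ _ _ _ "(/)"] sum.cong refl Suc.IH[where f = "\<lambda>es. f (_ # es)"]) auto
  also have "\<dots> = (\<Sum>x\<in>A. perm_avg (A - {x}) (\<lambda>es.
       (\<Sum>y\<in>A - set (take (Suc t) (x # es)). f (take (Suc t) (x # es) @ [y])) / (card A - Suc t))) / card A"
    using Suc.prems by (intro arg_cong2[of _ _ _ _ "(/)"] sum.cong refl perm_avg_cong)
       (auto simp: Diff_insert2[symmetric] intro!: sum.cong)
  also have "\<dots> = perm_avg A (\<lambda>es. (\<Sum>y\<in>A - set (take (Suc t) es). f (take (Suc t) es @ [y])) / (card A - Suc t))"
    by (subst perm_avg_Cons[OF Suc(2) ne]) simp
  finally show ?case .
qed

text \<open>Rotation permutes the orderings of \<open>A\<close>. It moves a window starting at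
  position \<open>t\<close> to the front, so that bounds for prefixes apply to windows.\<close>

lemma perm_avg_rotate:
  assumes "finite A"
  shows "perm_avg A (\<lambda>es. f (rotate t es)) = perm_avg A f"
proof -
  have "bij_betw (rotate t) (permutations_of_set A) (permutations_of_set A)"
  proof (rule bij_betwI')
    fix x y :: "'a list"
    show "(rotate t x = rotate t y) = (x = y)"
    proof
      assume *: "rotate t x = rotate t y"
      then have "length x = length y" by (metis length_rotate)
      have "rotate (length x - t mod length x) (rotate t x) = x" for x :: "'a list"
        by (metis add.commute le_add_diff_inverse length_0_conv length_greater_0_conv less_imp_le
           mod_less_divisor rotate_conv_mod rotate_id rotate_rotate mod_self rotate_is_Nil_conv)
      then show "x = y" using * \<open>length x = length y\<close> by metis
    qed simp
  next
    fix y assume y: "y \<in> permutations_of_set A"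
    have "rotate t (rotate (length y - t mod length y) y) = y"
        by (metis add.commute le_add_diff_inverse length_0_conv length_greater_0_conv less_imp_le
           mod_less_divisor rotate_conv_mod rotate_id rotate_rotate mod_self rotate_is_Nil_conv length_rotate)
    then show "\<exists>x\<in>permutations_of_set A. y = rotate t x"
      using y by (intro bexI[of _ "rotate (length y - t mod length y) y"]) (auto simp: permutations_of_set_def)
  qed (auto simp: permutations_of_set_def)
  then show ?thesis
    unfolding perm_avg_def by (simp add: sum.reindex_bij_betw)
qed

text \<open>A Chernoff bound for sampling without replacement. While at most \<open>j\<close>
  elements of \<open>F\<close> have been drawn, at least \<open>card F - j\<close> remain among at
  most \<open>card A\<close> elements, so one draw multiplies the mean of \<open>z ^ hits\<close> by
  at most \<open>c\<close>. Markov's inequality then contributes \<open>(1 / z) ^ j\<close>.\<close>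

lemma prefix_hits_le:
  fixes z :: real
  assumes A: "finite A" "F \<subseteq> A" and z: "0 < z" "z \<le> 1" and j: "j \<le> card F" and m: "m \<le> card A"
  shows "perm_avg A (\<lambda>es. of_bool (card (set (take m es) \<inter> F) \<le> j))
      \<le> (1 / z) ^ j * (1 - (1 - z) * (card F - j) / card A) ^ m"
proof -
  define c where "c = 1 - (1 - z) * (card F - j) / card A"
  \<comment> \<open>The indicator kills the process once the count exceeds \<open>j\<close>, because
    the one-step estimate fails from there on.\<close>
  define \<phi> where "\<phi> = (\<lambda>xs. of_bool (card (set xs \<inter> F) \<le> j) * z ^ card (set xs \<inter> F))"
  have fF: "finite F" using A finite_subset by auto
  have "card F \<le> card A" using A card_mono by blast
  have c0: "c \<ge> 0"
  proof -
    have "(1 - z) * real (card F - j) \<le> 1 * real (card A)" using z \<open>card F \<le> card A\<close> j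
      by (intro mult_mono) auto
    then show ?thesis unfolding c_def using card_gt_0_iff[of A] by (cases "card A = 0") (auto simp: divide_simps)
  qed
  have main: "perm_avg A (\<lambda>es. \<phi> (take t es)) \<le> c ^ t" if "t \<le> card A" for t
    using that
  proof (induction t)
    case 0
    then show ?case by (simp add: \<phi>_def perm_avg_const A)
  next
    case (Suc t)
    have step: "(\<Sum>x\<in>A - set (take t es). \<phi> (take t es @ [x])) / (card A - t) \<le> c * \<phi> (take t es)"
      if es: "es \<in> permutations_of_set A" for es
    proof -
      define h where "h = card (set (take t es) \<inter> F)"
      have les: "length es = card A" "set es = A" "distinct es"
        using es A by (auto simp: permutations_of_set_def distinct_card)
      have cs: "card (set (take t es)) = t"
        using les Suc.prems by (simp add: distinct_card)
      have sub: "set (take t es) \<subseteq> A" using les set_take_subset by metis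
      have cR: "card (A - set (take t es)) = card A - t"
        using cs sub by (simp add: card_Diff_subset)
      show ?thesis
      proof (cases "h \<le> j")
        case False
        have "\<phi> (take t es @ [x]) = 0" for x
        proof -
          have "h \<le> card (set (take t es @ [x]) \<inter> F)"
            unfolding h_def using fF by (intro card_mono) auto
          then show ?thesis using False by (simp add: \<phi>_def)
        qed
        moreover have "\<phi> (take t es) = 0" using False by (simp add: \<phi>_def h_def)
        ultimately show ?thesis by simp
      next
        case True
        have "(\<Sum>x\<in>A - set (take t es). \<phi> (take t es @ [x]))
           \<le> (\<Sum>x\<in>A - set (take t es). z ^ h * (1 - (1 - z) * of_bool (x \<in> F)))"
        proof (intro sum_mono)
          fix x assume x: "x \<in> A - set (take t es)"
          have "card (set (take t es @ [x]) \<inter> F) = (if x \<in> F then Suc h else h)"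
            using x fF unfolding h_def by auto
          then show "\<phi> (take t es @ [x]) \<le> z ^ h * (1 - (1 - z) * of_bool (x \<in> F))"
            using z by (auto simp: \<phi>_def)
        qed
        also have "\<dots> = z ^ h * ((card A - t) - (1 - z) * card (F - set (take t es)))"
        proof -
          have "(A - set (take t es)) \<inter> F = F - set (take t es)" using A by auto
          then show ?thesis
            using A cR Suc.prems by (simp add: sum_distrib_left[symmetric] sum_subtractf of_nat_diff Int_def[symmetric])
        qed
        also have "card (F - set (take t es)) = card F - h"
          unfolding h_def using fF by (metis card_Diff_subset_Int finite_Int inf_commute)
        also have "z ^ h * ((card A - t) - (1 - z) * real (card F - h)) / (card A - t)
             = z ^ h * (1 - (1 - z) * real (card F - h) / (card A - t))"
          using Suc.prems by (simp add: field_simps)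
        also have "\<dots> \<le> z ^ h * c"
        proof -
          have "(1 - z) * (card F - j) / card A \<le> (1 - z) * real (card F - h) / (card A - t)"
            using True j z Suc.prems by (intro frac_le mult_left_mono) (auto simp: of_nat_diff)
          then show ?thesis unfolding c_def using z Suc.prems by (intro mult_left_mono) auto
        qed
        also have "\<dots> = c * \<phi> (take t es)" using True by (simp add: \<phi>_def h_def)
        finally show ?thesis using Suc.prems by (simp add: divide_right_mono)
      qed
    qed
    have "perm_avg A (\<lambda>es. \<phi> (take (Suc t) es)) \<le> perm_avg A (\<lambda>es. c * \<phi> (take t es))"
      using Suc.prems by (subst perm_avg_prefix_Suc[OF A(1)]) (rule perm_avg_mono, erule step | simp)+
    also have "\<dots> \<le> c * c ^ t" using Suc c0 by (simp add: perm_avg_cmult mult_left_mono)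
    finally show ?case by simp
  qed
  have "perm_avg A (\<lambda>es. of_bool (card (set (take m es) \<inter> F) \<le> j))
     \<le> perm_avg A (\<lambda>es. (1 / z) ^ j * \<phi> (take m es))"
  proof (intro perm_avg_mono)
    fix es
    have "z ^ j \<le> z ^ card (set (take m es) \<inter> F)" if "card (set (take m es) \<inter> F) \<le> j"
      using z that by (intro power_decreasing) auto
    then show "of_bool (card (set (take m es) \<inter> F) \<le> j) \<le> (1 / z) ^ j * \<phi> (take m es)"
      using z by (auto simp: \<phi>_def field_simps)
  qed
  also have "\<dots> \<le> (1 / z) ^ j * c ^ m"
    unfolding perm_avg_cmult using z main[OF m] by (intro mult_left_mono) auto
  finally show ?thesis by (simp add: c_def)
qed

text \<open>Only the positive part of the deviation has a controlled second moment, since a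
  supermartingale may drift down arbitrarily far. In the expansion of the square the cross term is a
  nonnegative factor times the drift, hence at most 0, and each step adds at most
  \<open>c\<^sup>2\<close>.\<close>

lemma supermartingale_upper_deviation:
  fixes \<Psi> :: "'a list \<Rightarrow> real"
  assumes A: "finite A"
    and drift: "\<And>xs. distinct xs \<Longrightarrow> set xs \<subseteq> A \<Longrightarrow> (\<Sum>x\<in>A - set xs. \<Psi> (xs @ [x]) - \<Psi> xs) \<le> 0"
    and bounded: "\<And>xs x. distinct xs \<Longrightarrow> set xs \<subseteq> A \<Longrightarrow> x \<in> A - set xs \<Longrightarrow> \<bar>\<Psi> (xs @ [x]) - \<Psi> xs\<bar> \<le> c"
    and t: "t \<le> card A"
  shows "perm_avg A (\<lambda>es. (max 0 (\<Psi> (take t es) - \<Psi> []))\<^sup>2) \<le> c\<^sup>2 * t"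
  using t
proof (induction t)
  case 0
  then show ?case by (simp add: perm_avg_const A)
next
  case (Suc t)
  define p where "p = (\<lambda>xs. max 0 (\<Psi> xs - \<Psi> []))"
  have step: "(\<Sum>x\<in>A - set (take t es). (p (take t es @ [x]))\<^sup>2) / (card A - t) \<le> (p (take t es))\<^sup>2 + c\<^sup>2"
    if es: "es \<in> permutations_of_set A" for es
  proof -
    define xs where "xs = take t es"
    have les: "length es = card A" "set es = A" "distinct es"
      using es A by (auto simp: permutations_of_set_def distinct_card)
    have xs: "distinct xs" "set xs \<subseteq> A"
      unfolding xs_def using les set_take_subset by (force, metis)
    have cs: "card (set xs) = t"
      using les Suc.prems by (simp add: xs_def distinct_card)
    have cR: "card (A - set xs) = card A - t"
      using cs xs by (simp add: card_Diff_subset)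
    have "(\<Sum>x\<in>A - set xs. (p (xs @ [x]))\<^sup>2)
       \<le> (\<Sum>x\<in>A - set xs. (p xs)\<^sup>2 + 2 * p xs * (\<Psi> (xs @ [x]) - \<Psi> xs) + c\<^sup>2)"
    proof (intro sum_mono)
      fix x assume x: "x \<in> A - set xs"
      define d where "d = \<Psi> (xs @ [x]) - \<Psi> xs"
      have d: "d\<^sup>2 \<le> c\<^sup>2" using bounded[OF xs x] unfolding d_def[symmetric]
        by (metis abs_le_square_iff abs_ge_zero abs_of_nonneg order_trans)
      \<comment> \<open>The function \<open>(max 0 y)\<^sup>2\<close> has derivative
        \<open>2 * max 0 y\<close>, which is 2-Lipschitz; this is its quadratic upper bound.\<close>
      have "(max 0 (y + d))\<^sup>2 \<le> (max 0 y)\<^sup>2 + 2 * max 0 y * d + d\<^sup>2" for y :: real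
      proof (cases "y \<ge> 0")
        case True
        have "(max 0 (y + d))\<^sup>2 \<le> (y + d)\<^sup>2" by (auto simp: max_def)
        then show ?thesis using True by (simp add: power2_sum)
      next
        case False
        then have "(max 0 (y + d))\<^sup>2 \<le> d\<^sup>2" by (auto simp: max_def intro!: power_mono)
        then show ?thesis using False by simp
      qed
      from this[of "\<Psi> xs - \<Psi> []"] d
      show "(p (xs @ [x]))\<^sup>2 \<le> (p xs)\<^sup>2 + 2 * p xs * (\<Psi> (xs @ [x]) - \<Psi> xs) + c\<^sup>2"
        by (simp add: p_def d_def)
    qed
    also have "\<dots> = (card A - t) * ((p xs)\<^sup>2 + c\<^sup>2) + 2 * p xs * (\<Sum>x\<in>A - set xs. \<Psi> (xs @ [x]) - \<Psi> xs)"
      using cR by (simp add: sum.distrib flip: sum_distrib_left) (simp add: algebra_simps)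
    also have "\<dots> \<le> (card A - t) * ((p xs)\<^sup>2 + c\<^sup>2)"
    proof -
      have "p xs \<ge> 0" by (simp add: p_def)
      then have "2 * p xs * (\<Sum>x\<in>A - set xs. \<Psi> (xs @ [x]) - \<Psi> xs) \<le> 0"
        using drift[OF xs] by (intro mult_nonneg_nonpos) auto
      then show ?thesis by linarith
    qed
    finally show ?thesis using Suc.prems unfolding xs_def[symmetric]
      by (subst pos_divide_le_eq) (auto simp: mult.commute)
  qed
  have "perm_avg A (\<lambda>es. (p (take (Suc t) es))\<^sup>2) \<le> perm_avg A (\<lambda>es. (p (take t es))\<^sup>2 + c\<^sup>2)"
    using Suc.prems by (subst perm_avg_prefix_Suc[OF A(1)]) (rule perm_avg_mono, erule step | simp)+
  also have "\<dots> = perm_avg A (\<lambda>es. (p (take t es))\<^sup>2) + c\<^sup>2"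
    by (simp add: perm_avg_add perm_avg_const A)
  also have "\<dots> \<le> c\<^sup>2 * t + c\<^sup>2" using Suc by (simp add: p_def)
  finally show ?case by (simp add: p_def algebra_simps)
qed

section \<open>Late edges\<close>

lemma finite_complete_edges [simp]: "finite (complete_edges n)"
  by (rule finite_subset[of _ "Pow {1..n}"]) (auto simp: complete_edges_def)

lemma card_complete_edges: "card (complete_edges n) = n choose 2"
  using n_subsets[of "{1..n}" 2] by (simp add: complete_edges_def)

lemma vertex_degree_insert:
  assumes "finite E" "e \<notin> E"
  shows "vertex_degree (insert e E) v = vertex_degree E v + of_bool (v \<in> e)"
proof -
  have "{e' \<in> insert e E. v \<in> e'} = (if v \<in> e then insert e {e' \<in> E. v \<in> e'} else {e' \<in> E. v \<in> e'})"
    by auto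
  then show ?thesis using assms by (simp add: vertex_degree_def)
qed

lemma vertex_degree_mono: "E \<subseteq> E' \<Longrightarrow> finite E' \<Longrightarrow> vertex_degree E v \<le> vertex_degree E' v"
  unfolding vertex_degree_def by (intro card_mono) auto

lemma star_eq:
  assumes "v \<in> {1..n}"
  shows "{e \<in> complete_edges n. v \<in> e} = (\<lambda>w. {v, w}) ` ({1..n} - {v})"
  using assms by (auto simp: complete_edges_def card_2_iff image_iff doubleton_eq_iff)

lemma card_star:
  assumes "v \<in> {1..n}"
  shows "card {e \<in> complete_edges n. v \<in> e} = n - 1"
proof -
  have "inj_on (\<lambda>w. {v, w}) ({1..n} - {v})" by (auto simp: inj_on_def doubleton_eq_iff)
  then show ?thesis using assms by (simp add: star_eq card_image)
qed

lemma card_remaining_star: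
  assumes "v \<in> {1..n}" "E \<subseteq> complete_edges n"
  shows "card {e \<in> complete_edges n - E. v \<in> e} = n - 1 - vertex_degree E v"
proof -
  have "{e \<in> complete_edges n - E. v \<in> e} = {e \<in> complete_edges n. v \<in> e} - {e \<in> E. v \<in> e}" by auto
  moreover have "finite E" using assms(2) finite_subset finite_complete_edges by blast
  ultimately show ?thesis using assms card_star[of v n]
    by (simp add: card_Diff_subset vertex_degree_def Collect_mono_iff subset_eq)
qed

section \<open>The late edges and their potential\<close>

text \<open>Degrees refer to the random graph, not to Builder's graph, so the number of late edges
  does not depend on her decisions and can be analysed as a function of the edge order
  alone.\<close>

definition late_edge :: "nat \<Rightarrow> edge set \<Rightarrow> edge \<Rightarrow> bool" where
  "late_edge k E e \<longleftrightarrow> (\<exists>u\<in>e. \<exists>v\<in>e. vertex_degree E u = 0 \<and> k \<le> vertex_degree E v)"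

definition late_count :: "nat \<Rightarrow> edge list \<Rightarrow> nat" where
  "late_count k xs = card {i. i < length xs \<and> late_edge k (set (take i xs)) (xs ! i)}"

lemma late_count_Nil [simp]: "late_count k [] = 0"
  by (simp add: late_count_def)

lemma late_count_snoc: "late_count k (xs @ [x]) = late_count k xs + of_bool (late_edge k (set xs) x)"
proof -
  have "{i. i < length (xs @ [x]) \<and> late_edge k (set (take i (xs @ [x]))) ((xs @ [x]) ! i)} =
    {i. i < length xs \<and> late_edge k (set (take i xs)) (xs ! i)} \<union> (if late_edge k (set xs) x then {length xs} else {})"
    by (auto simp: nth_append less_Suc_eq split: if_splits)
  then show ?thesis by (simp add: late_count_def)
qed

definition isolated :: "nat \<Rightarrow> edge set \<Rightarrow> nat set" where
  "isolated n E = {v \<in> {1..n}. vertex_degree E v = 0}"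

text \<open>Each term is the heuristic probability that v gains its missing edges before a given
  isolated vertex is touched, both being equally likely to be hit next. Truncated subtraction gives
  saturated vertices the value 1.\<close>

definition weight :: "nat \<Rightarrow> nat \<Rightarrow> edge set \<Rightarrow> real" where
  "weight n k E = (\<Sum>v\<in>{1..n}. (1 / 2) ^ (k - vertex_degree E v))"

text \<open>Late edges so far plus a prediction of those to come: the first edge at an isolated
  vertex picks each of the n - 1 possible partners about equally often, and is late if the partner
  has saturated by then.\<close>

definition late_potential :: "nat \<Rightarrow> nat \<Rightarrow> edge list \<Rightarrow> real" where
  "late_potential n k xs =
     late_count k xs + card (isolated n (set xs)) * weight n k (set xs) / (real n - 1)"

lemma sum_edges_sum_ends:
  fixes h :: "nat \<Rightarrow> real"
  assumes "R \<subseteq> complete_edges n"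
  shows "(\<Sum>e\<in>R. \<Sum>v\<in>e. h v) = (\<Sum>v\<in>{1..n}. h v * card {e \<in> R. v \<in> e})"
proof -
  have fR: "finite R" using assms finite_subset finite_complete_edges by blast
  have "(\<Sum>e\<in>R. \<Sum>v\<in>e. h v) = (\<Sum>e\<in>R. \<Sum>v\<in>{1..n}. if v \<in> e then h v else 0)"
  proof (rule sum.cong[OF refl])
    fix e assume "e \<in> R"
    then have "{1..n} \<inter> e = e" using assms by (auto simp: complete_edges_def)
    then show "(\<Sum>v\<in>e. h v) = (\<Sum>v\<in>{1..n}. if v \<in> e then h v else 0)"
      by (simp add: sum.If_cases Int_def[symmetric])
  qed
  also have "\<dots> = (\<Sum>v\<in>{1..n}. \<Sum>e\<in>R. if v \<in> e then h v else 0)" by (rule sum.swap)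
  also have "\<dots> = (\<Sum>v\<in>{1..n}. h v * card {e \<in> R. v \<in> e})"
    using fR by (simp add: sum.If_cases Int_def mult.commute)
  finally show ?thesis .
qed

lemma weight_insert:
  assumes "finite E" "e \<notin> E" "e \<in> complete_edges n"
  shows "weight n k (insert e E) = weight n k E +
    (\<Sum>v\<in>e. (if vertex_degree E v < k then (1 / 2) ^ (k - vertex_degree E v) else 0))"
proof -
  have *: "(1 / 2 :: real) ^ (k - (d + of_bool (v \<in> e))) = (1 / 2) ^ (k - d) +
     (if v \<in> e then (if d < k then (1 / 2) ^ (k - d) else 0) else 0)" for d v
  proof (cases "d < k")
    case True
    then have "k - d = Suc (k - Suc d)" by simp
    then show ?thesis using True by simp
  qed auto
  have "{1..n} \<inter> e = e" using assms by (auto simp: complete_edges_def)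
  then show ?thesis
    unfolding weight_def vertex_degree_insert[OF assms(1,2)] *
    by (simp add: sum.distrib sum.If_cases Int_def[symmetric])
qed

lemma weight_bounds: "0 \<le> weight n k E" "weight n k E \<le> n"
proof -
  show "0 \<le> weight n k E" by (auto simp: weight_def intro!: sum_nonneg)
  have "weight n k E \<le> (\<Sum>v\<in>{1..n}. 1)" unfolding weight_def
    by (intro sum_mono power_le_one) auto
  then show "weight n k E \<le> n" by simp
qed

lemma card_isolated_insert:
  assumes "finite E" "e \<notin> E" "e \<in> complete_edges n"
  shows "real (card (isolated n (insert e E))) =
    real (card (isolated n E)) - (\<Sum>v\<in>e. of_bool (vertex_degree E v = 0))"
proof -
  have e: "e \<subseteq> {1..n}" "finite e" using assms finite_subset by (auto simp: complete_edges_def)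
  have "isolated n (insert e E) = isolated n E - {v \<in> e. vertex_degree E v = 0}"
    by (auto simp: isolated_def vertex_degree_insert[OF assms(1,2)])
  moreover have "{v \<in> e. vertex_degree E v = 0} \<subseteq> isolated n E" "finite (isolated n E)"
    using e by (auto simp: isolated_def)
  moreover from this have "card {v \<in> e. vertex_degree E v = 0} \<le> card (isolated n E)"
    by (intro card_mono)
  ultimately have "real (card (isolated n (insert e E))) =
      real (card (isolated n E)) - real (card {v \<in> e. vertex_degree E v = 0})"
    using e by (simp add: card_Diff_subset of_nat_diff)
  then show ?thesis using e by (simp add: Int_def)
qed

lemma card_isolated_le: "card (isolated n E) \<le> n"
  using card_mono[of "{1..n}" "isolated n E"] by (simp add: isolated_def subset_iff)

text \<open>The weight of a vertex doubles with every edge until it saturates at degree \<open>k\<close>; this gain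
  exactly compensates the loss of isolated vertices, up to the expected number of new late edges.\<close>

lemma late_potential_drift:
  assumes xs: "distinct xs" "set xs \<subseteq> complete_edges n" and n: "n \<ge> 2" and k: "k \<ge> 1"
  shows "(\<Sum>e\<in>complete_edges n - set xs. late_potential n k (xs @ [e]) - late_potential n k xs) \<le> 0"
proof -
  define E where "E = set xs"
  define R where "R = complete_edges n - E"
  define d where "d = vertex_degree E"
  define I where "I = isolated n E"
  define D where "D = {v \<in> {1..n}. k \<le> d v}"
  define W where "W = weight n k E"
  define g :: "nat \<Rightarrow> real" where "g = (\<lambda>v. if d v < k then (1 / 2) ^ (k - d v) else 0)"
  define i :: "nat \<Rightarrow> real" where "i = (\<lambda>v. of_bool (d v = 0))"
  have fin: "finite E" "finite R" "R \<subseteq> complete_edges n" "finite I" "finite D"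
    by (auto simp: E_def R_def I_def D_def isolated_def)
  have W0: "W \<ge> 0" unfolding W_def by (rule weight_bounds)
  have n1: "real n - 1 > 0" using n by simp
  have one: "late_potential n k (xs @ [e]) - late_potential n k xs \<le>
     of_bool (late_edge k E e) + (card I * (\<Sum>v\<in>e. g v) - (\<Sum>v\<in>e. i v) * W) / (real n - 1)" if e: "e \<in> R" for e
  proof -
    have e': "e \<notin> E" "e \<in> complete_edges n" using e by (auto simp: R_def)
    \<comment> \<open>This is the second-order term of the change of the product. It enters with a
      minus sign and may be dropped.\<close>
    have "0 \<le> (\<Sum>v\<in>e. i v) * (\<Sum>v\<in>e. g v)" by (intro mult_nonneg_nonneg sum_nonneg) (auto simp: i_def g_def)
    then have "(card I - (\<Sum>v\<in>e. i v)) * (W + (\<Sum>v\<in>e. g v)) - card I * W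
       \<le> card I * (\<Sum>v\<in>e. g v) - (\<Sum>v\<in>e. i v) * W"
      by (simp add: algebra_simps)
    moreover have "late_potential n k (xs @ [e]) - late_potential n k xs = of_bool (late_edge k E e)
       + ((card I - (\<Sum>v\<in>e. i v)) * (W + (\<Sum>v\<in>e. g v)) - card I * W) / (real n - 1)"
      using n by (simp add: late_potential_def late_count_snoc weight_insert card_isolated_insert fin e'
         diff_divide_distrib W_def I_def g_def i_def d_def cong: if_cong flip: E_def)
    ultimately show ?thesis using n by (simp add: divide_right_mono)
  qed
  have late: "(\<Sum>e\<in>R. of_bool (late_edge k E e)) \<le> real (card I * card D)"
  proof -
    have "{e \<in> R. late_edge k E e} \<subseteq> (\<lambda>(u, v). {u, v}) ` (I \<times> D)"
    proof
      fix e assume "e \<in> {e \<in> R. late_edge k E e}"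
      then obtain u v where uv: "u \<in> e" "v \<in> e" "d u = 0" "k \<le> d v" and e: "e \<subseteq> {1..n}" "card e = 2"
        by (auto simp: late_edge_def d_def R_def complete_edges_def)
      \<comment> \<open>As \<open>k \<ge> 1\<close>, an isolated vertex is not saturated, so the
        pair determines the edge.\<close>
      with k have "u \<noteq> v" by auto
      with uv e have "e = {u, v}" by (auto simp: card_2_iff)
      then show "e \<in> (\<lambda>(u, v). {u, v}) ` (I \<times> D)"
        using uv e by (force simp: I_def D_def isolated_def d_def)
    qed
    then have "card {e \<in> R. late_edge k E e} \<le> card (I \<times> D)"
      using fin by (intro surj_card_le) auto
    then show ?thesis using fin by (simp add: Int_def card_cartesian_product flip: of_nat_mult)
  qed
  have rem: "card {e \<in> R. v \<in> e} = n - 1 - d v" if "v \<in> {1..n}" for v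
    unfolding R_def d_def using that xs by (intro card_remaining_star) (auto simp: E_def)
  have sumi: "(\<Sum>e\<in>R. \<Sum>v\<in>e. i v) = card I * (real n - 1)"
  proof -
    have "(\<Sum>e\<in>R. \<Sum>v\<in>e. i v) = (\<Sum>v\<in>{1..n}. i v * card {e \<in> R. v \<in> e})"
      by (rule sum_edges_sum_ends) (fact fin)
    also have "\<dots> = (\<Sum>v\<in>{1..n}. of_bool (d v = 0) * (real n - 1))"
      using n by (intro sum.cong refl) (auto simp: i_def rem)
    also have "\<dots> = card I * (real n - 1)"
      by (simp add: I_def isolated_def d_def Int_def flip: sum_distrib_right)
    finally show ?thesis .
  qed
  have sumg: "(\<Sum>e\<in>R. \<Sum>v\<in>e. g v) \<le> (W - card D) * (real n - 1)"
  proof -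
    have "(\<Sum>e\<in>R. \<Sum>v\<in>e. g v) = (\<Sum>v\<in>{1..n}. g v * card {e \<in> R. v \<in> e})"
      by (rule sum_edges_sum_ends) (fact fin)
    also have "\<dots> \<le> (\<Sum>v\<in>{1..n}. g v * (real n - 1))"
      using n by (intro sum_mono mult_left_mono) (auto simp: rem g_def)
    also have "\<dots> = (\<Sum>v\<in>{1..n}. (1 / 2) ^ (k - d v) - of_bool (k \<le> d v)) * (real n - 1)"
      unfolding sum_distrib_right by (intro sum.cong refl) (auto simp: g_def)
    also have "\<dots> = (W - card D) * (real n - 1)"
      by (simp add: W_def D_def weight_def d_def sum_subtractf Int_def)
    finally show ?thesis .
  qed
  have "(\<Sum>e\<in>R. late_potential n k (xs @ [e]) - late_potential n k xs) \<le>
     (\<Sum>e\<in>R. of_bool (late_edge k E e) + (card I * (\<Sum>v\<in>e. g v) - (\<Sum>v\<in>e. i v) * W) / (real n - 1))"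
    by (intro sum_mono one)
  also have "\<dots> = (\<Sum>e\<in>R. of_bool (late_edge k E e)) +
      (card I * (\<Sum>e\<in>R. \<Sum>v\<in>e. g v) - (\<Sum>e\<in>R. \<Sum>v\<in>e. i v) * W) / (real n - 1)"
    by (simp add: sum.distrib sum_subtractf flip: sum_distrib_left sum_distrib_right sum_divide_distrib)
  also have "\<dots> \<le> real (card I * card D) +
     (card I * ((W - card D) * (real n - 1)) - (card I * (real n - 1)) * W) / (real n - 1)"
    using n1 sumg n unfolding sumi by (intro add_mono late divide_right_mono diff_right_mono mult_left_mono) auto
  \<comment> \<open>With the factor \<open>n - 1\<close> cancelled, the three contributions are I D,
    I (W - D) and - I W for the respective sizes.\<close>
  also have "\<dots> = 0" using n n1 by (simp add: field_simps)
  finally show ?thesis by (simp add: R_def E_def)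
qed

text \<open>Both factors of the product are at most n and move by at most 2, in opposite directions,
  so the product changes by at most 2 n, and after division by n - 1 by at most 4. The late count
  adds at most 1.\<close>

lemma late_potential_bounded:
  assumes xs: "distinct xs" "set xs \<subseteq> complete_edges n" and e: "e \<in> complete_edges n - set xs"
    and n: "n \<ge> 2"
  shows "\<bar>late_potential n k (xs @ [e]) - late_potential n k xs\<bar> \<le> 5"
proof -
  define I I' where "I = real (card (isolated n (set xs)))" and "I' = real (card (isolated n (insert e (set xs))))"
  define W W' where "W = weight n k (set xs)" and "W' = weight n k (insert e (set xs))"
  have e': "e \<notin> set xs" "e \<in> complete_edges n" "card e = 2" using e by (auto simp: complete_edges_def)
  have b: "0 \<le> I'" "I' \<le> n" "0 \<le> W" "W \<le> n"
    by (auto simp: I'_def W_def card_isolated_le weight_bounds)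
  have "(\<Sum>v\<in>e. of_bool (vertex_degree (set xs) v = 0)) \<le> (\<Sum>v\<in>e. 1 :: real)"
    by (intro sum_mono) auto
  moreover have "(\<Sum>v\<in>e. of_bool (vertex_degree (set xs) v = 0)) \<ge> (0 :: real)" by (intro sum_nonneg) auto
  ultimately have dI: "0 \<le> I - I'" "I - I' \<le> 2"
    using e' card_isolated_insert[OF _ e'(1,2)] by (auto simp: I_def I'_def)
  have "(\<Sum>v\<in>e. if vertex_degree (set xs) v < k then (1 / 2) ^ (k - vertex_degree (set xs) v) else 0)
     \<le> (\<Sum>v\<in>e. 1 :: real)"
    by (intro sum_mono) (auto intro: power_le_one)
  moreover have "(\<Sum>v\<in>e. if vertex_degree (set xs) v < k then (1 / 2) ^ (k - vertex_degree (set xs) v) else 0) \<ge> (0 :: real)"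
    by (intro sum_nonneg) auto
  ultimately have dW: "0 \<le> W' - W" "W' - W \<le> 2"
    using e' weight_insert[OF _ e'(1,2), of k] by (auto simp: W_def W'_def)
  have "I' * (W' - W) \<le> real n * 2" "(I - I') * W \<le> 2 * real n"
    using b dI dW by (auto intro!: mult_mono)
  moreover have "0 \<le> I' * (W' - W)" "0 \<le> (I - I') * W" using b dI dW by auto
  moreover have "I' * W' - I * W = I' * (W' - W) - (I - I') * W" by (simp add: algebra_simps)
  ultimately have "\<bar>I' * W' - I * W\<bar> \<le> 2 * real n" by linarith
  also have "\<dots> \<le> 4 * (real n - 1)" using n by simp
  finally have "\<bar>(I' * W' - I * W) / (real n - 1)\<bar> \<le> 4"
    using n by (simp add: abs_divide pos_divide_le_eq)
  moreover have "late_potential n k (xs @ [e]) - late_potential n k xs =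
      of_bool (late_edge k (set xs) e) + (I' * W' - I * W) / (real n - 1)"
    using n by (simp add: late_potential_def late_count_snoc diff_divide_distrib I_def W_def I'_def W'_def of_nat_diff)
  moreover have "\<bar>of_bool b + x\<bar> \<le> 5" if "\<bar>x\<bar> \<le> 4" for b and x :: real using that by (cases b) auto
  ultimately show ?thesis by simp
qed

text \<open>Markov's inequality for the squared positive part of the deviation, with increments at
  most 5. The initial potential is \<open>(n / 2 ^ k) * (n / (n - 1))\<close>, and bounding the last
  factor by 2 is affordable: a late edge enters the final cost only with coefficient one
  half.\<close>

lemma late_count_upper_tail:
  assumes n: "n \<ge> 2" and k: "k \<ge> 1" and t: "t \<le> n choose 2" and a: "a > 0"
  shows "perm_avg (complete_edges n) (\<lambda>es. of_bool (late_count k (take t es) > 2 * n / 2 ^ k + a)) \<le> 25 * t / a\<^sup>2"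
proof -
  have init: "late_potential n k [] \<le> 2 * n / 2 ^ k"
  proof -
    have "isolated n {} = {1..n}" "weight n k {} = n / 2 ^ k"
      by (auto simp: isolated_def weight_def vertex_degree_def power_one_over field_simps)
    then have "late_potential n k [] = (n / 2 ^ k) * (n / (real n - 1))"
      by (simp add: late_potential_def)
    also have "\<dots> \<le> (n / 2 ^ k) * 2" using n by (intro mult_left_mono) (auto simp: pos_divide_le_eq)
    finally show ?thesis by (simp add: mult.commute)
  qed
  have "perm_avg (complete_edges n) (\<lambda>es. of_bool (late_count k (take t es) > 2 * n / 2 ^ k + a))
     \<le> perm_avg (complete_edges n) (\<lambda>es. (1 / a\<^sup>2) * (max 0 (late_potential n k (take t es) - late_potential n k []))\<^sup>2)"
  proof (intro perm_avg_mono)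
    fix es
    have "late_count k (take t es) \<le> late_potential n k (take t es)"
      using weight_bounds(1)[of n k] n by (simp add: late_potential_def)
    then have "a\<^sup>2 \<le> (max 0 (late_potential n k (take t es) - late_potential n k []))\<^sup>2"
      if "late_count k (take t es) > 2 * n / 2 ^ k + a"
      using that init a by (intro power_mono) auto
    then show "of_bool (late_count k (take t es) > 2 * n / 2 ^ k + a) \<le>
      (1 / a\<^sup>2) * (max 0 (late_potential n k (take t es) - late_potential n k []))\<^sup>2"
      using a by (auto simp: pos_le_divide_eq)
  qed
  also have "\<dots> \<le> (1 / a\<^sup>2) * (5\<^sup>2 * real t)"
    unfolding perm_avg_cmult
    by (intro mult_left_mono supermartingale_upper_deviation[OF finite_complete_edges]
          late_potential_drift[OF _ _ n k] late_potential_bounded[OF _ _ _ n])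
       (use t in \<open>auto simp: card_complete_edges\<close>)
  finally show ?thesis by simp
qed

section \<open>Builder's rule\<close>

definition wants :: "nat \<Rightarrow> nat \<Rightarrow> nat \<Rightarrow> edge set \<Rightarrow> edge \<Rightarrow> bool" where
  "wants k T t B e \<longleftrightarrow> (if t < T
     then (\<exists>v\<in>e. vertex_degree B v = 0) \<or> (\<forall>v\<in>e. vertex_degree B v < k)
     else (\<exists>v\<in>e. vertex_degree B v < k))"

text \<open>The purchases without any budget, on which all counting is done. Only the entries before
  position \<open>t\<close> matter, so an online player can simulate it.\<close>

primrec bought :: "nat \<Rightarrow> nat \<Rightarrow> edge list \<Rightarrow> nat \<Rightarrow> edge set" where
  "bought k T es 0 = {}"
| "bought k T es (Suc t) =
     bought k T es t \<union> (if wants k T t (bought k T es t) (es ! t) then {es ! t} else {})"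

text \<open>The current edge has index \<open>length xs - 1\<close>. The cap compares the simulated
  total, current edge included, with \<open>b\<close>. This total never decreases, so after the
  first refusal for lack of budget nothing is bought any more, and the simulation agrees with the
  real purchases until then.\<close>

definition budget_rule :: "nat \<Rightarrow> nat \<Rightarrow> real \<Rightarrow> online_rule" where
  "budget_rule k T b xs \<longleftrightarrow> (let t = length xs - 1 in
     wants k T t (bought k T xs t) (xs ! t) \<and> real (card (bought k T xs (Suc t))) \<le> b)"

lemma bought_take: "t \<le> s \<Longrightarrow> bought k T (take s es) t = bought k T es t"
  by (induction t) auto

lemma finite_bought [simp]: "finite (bought k T es t)"
  by (induction t) auto

lemma bought_mono: "s \<le> t \<Longrightarrow> bought k T es s \<subseteq> bought k T es t"
  by (induction t rule: dec_induct) auto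

lemma bought_eq: "bought k T es t = {es ! j |j. j < t \<and> wants k T j (bought k T es j) (es ! j)}"
  by (induction t) (auto simp: less_Suc_eq)

lemma bought_subset: "t \<le> length es \<Longrightarrow> bought k T es t \<subseteq> set (take t es)"
  unfolding bought_eq[of _ _ _ t] by (force simp: in_set_conv_nth)

lemma builder_graph_budget_rule:
  "builder_graph (budget_rule k T b) es i = {es ! j |j. j < i \<and> j < length es \<and>
     wants k T j (bought k T es j) (es ! j) \<and> real (card (bought k T es (Suc j))) \<le> b}"
proof -
  have "budget_rule k T b (take (Suc j) es) \<longleftrightarrow>
     wants k T j (bought k T es j) (es ! j) \<and> real (card (bought k T es (Suc j))) \<le> b"
    if "j < length es" for j
    using that bought_take[of j "Suc j"] bought_take[of "Suc j" "Suc j"]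
    by (simp add: budget_rule_def Let_def del: bought.simps)
  then show ?thesis unfolding builder_graph_def by blast
qed

text \<open>Look at the last accepted edge: everything Builder owns was also bought in the
  simulation by that moment, and the simulated total was then within the budget.\<close>

lemma card_builder_graph_budget_rule:
  assumes "0 \<le> b"
  shows "real (card (builder_graph (budget_rule k T b) es i)) \<le> b"
proof -
  define J where "J = {j. j < i \<and> j < length es \<and>
     wants k T j (bought k T es j) (es ! j) \<and> real (card (bought k T es (Suc j))) \<le> b}"
  have B: "builder_graph (budget_rule k T b) es i = (!) es ` J"
    unfolding builder_graph_budget_rule J_def by blast
  show ?thesis
  proof (cases "J = {}")
    case True
    then show ?thesis using assms by (simp add: B)
  next
    case False
    have fin: "finite J" by (simp add: J_def)
    then have M: "Max J \<in> J" using False by simp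
    have "(!) es ` J \<subseteq> bought k T es (Suc (Max J))"
    proof
      fix e assume "e \<in> (!) es ` J"
      then obtain j where j: "j \<in> J" "e = es ! j" by auto
      then have "j < Suc (Max J)" using fin by (simp add: less_Suc_eq_le)
      moreover have "wants k T j (bought k T es j) (es ! j)" using j by (simp add: J_def)
      ultimately show "e \<in> bought k T es (Suc (Max J))"
        unfolding bought_eq[of _ _ _ "Suc (Max J)"] using j(2) by blast
    qed
    then have "card ((!) es ` J) \<le> card (bought k T es (Suc (Max J)))"
      by (intro card_mono finite_bought)
    moreover have "real (card (bought k T es (Suc j))) \<le> b" if "j \<in> J" for j
      using that unfolding J_def by blast
    from this[OF M] have "real (card (bought k T es (Suc (Max J)))) \<le> b" .
    ultimately show ?thesis by (simp add: B)
  qed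
qed

lemma builder_graph_budget_rule_eq_bought:
  assumes "i \<le> length es" "real (card (bought k T es i)) \<le> b"
  shows "builder_graph (budget_rule k T b) es i = bought k T es i"
proof -
  have "real (card (bought k T es (Suc j))) \<le> b" if "j < i" for j
  proof -
    have "card (bought k T es (Suc j)) \<le> card (bought k T es i)"
      using that by (intro card_mono bought_mono finite_bought) auto
    then show ?thesis using assms by linarith
  qed
  then show ?thesis
    unfolding builder_graph_budget_rule bought_eq[of _ _ _ i] using assms(1) by fastforce
qed

lemma edge_orderD:
  assumes "es \<in> permutations_of_set (complete_edges n)"
  shows "distinct es" "set es = complete_edges n" "length es = n choose 2"
    "set (take t es) \<subseteq> complete_edges n"
proof -
  show *: "distinct es" "set es = complete_edges n" using assms by (auto simp: permutations_of_set_def)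
  show "length es = n choose 2" using distinct_card[OF *(1)] *(2) card_complete_edges by metis
  show "set (take t es) \<subseteq> complete_edges n" using set_take_subset[of t es] * by simp
qed

lemma nth_edge:
  assumes "es \<in> permutations_of_set (complete_edges n)" "t < length es"
  shows "es ! t \<subseteq> {1..n}" "card (es ! t) = 2" "es ! t \<notin> set (take t es)" "es ! t \<notin> bought k T es t"
proof -
  have "es ! t \<in> complete_edges n" using assms edge_orderD(2) nth_mem by metis
  then show "es ! t \<subseteq> {1..n}" "card (es ! t) = 2" by (auto simp: complete_edges_def)
  show *: "es ! t \<notin> set (take t es)"
    using edge_orderD(1)[OF assms(1)] assms(2) by (auto simp: in_set_conv_nth nth_eq_iff_index_eq)
  show "es ! t \<notin> bought k T es t" using * bought_subset[of t es] assms(2) by auto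
qed

text \<open>An edge meeting a vertex of degree 0 in Builder's graph is accepted in either phase, in
  the second one because \<open>0 < k\<close>. So no touched vertex can remain without a
  purchase.\<close>

lemma touched_bought:
  assumes k: "k \<ge> 1" and t: "t \<le> length es" and v: "vertex_degree (set (take t es)) v > 0"
  shows "vertex_degree (bought k T es t) v > 0"
proof -
  have "{e \<in> set (take t es). v \<in> e} \<noteq> {}" using v by (auto simp: vertex_degree_def card_gt_0_iff)
  then obtain i where i: "i < t" "v \<in> es ! i" using t by (auto simp: in_set_conv_nth)
  show ?thesis
  proof (cases "vertex_degree (bought k T es i) v > 0")
    case True
    then show ?thesis using vertex_degree_mono[OF bought_mono[of i t] finite_bought] i
      by (meson less_imp_le order_less_le_trans)
  next
    case False
    then have "wants k T i (bought k T es i) (es ! i)" using i k by (force simp: wants_def)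
    then have "es ! i \<in> bought k T es t" using i by (auto simp: bought_eq[of _ _ _ t])
    then show ?thesis using i by (auto simp: vertex_degree_def card_gt_0_iff)
  qed
qed

section \<open>The number of purchases\<close>

definition capped_degrees :: "nat \<Rightarrow> nat \<Rightarrow> edge set \<Rightarrow> nat" where
  "capped_degrees n k B = (\<Sum>v\<in>{1..n}. min k (vertex_degree B v))"

lemma capped_degrees_insert:
  assumes "finite B" "e \<notin> B" "e \<subseteq> {1..n}"
  shows "capped_degrees n k (insert e B) = capped_degrees n k B + (\<Sum>v\<in>e. of_bool (vertex_degree B v < k))"
proof -
  have "min k (d + of_bool (v \<in> e)) = min k d + (if v \<in> e then of_bool (d < k) else 0)" for d v
    by auto
  moreover have "{1..n} \<inter> e = e" using assms by auto
  ultimately show ?thesis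
    unfolding capped_degrees_def vertex_degree_insert[OF assms(1,2)]
    by (simp add: sum.distrib sum.If_cases Int_def[symmetric])
qed

lemma capped_degrees_le: "capped_degrees n k B \<le> k * n"
  using sum_bounded_above[of "{1..n}" "\<lambda>v. min k (vertex_degree B v)" k]
  by (simp add: capped_degrees_def mult.commute)

text \<open>A purchase raises the capped degree sum by 2, or else by 1 and is late. In the second
  case one end is saturated and the other has degree 0 in Builder's graph; by
  \<open>touched_bought\<close> the latter is isolated in the random graph as well, and the former
  has degree at least \<open>k\<close> there.\<close>

lemma first_phase_count:
  assumes es: "es \<in> permutations_of_set (complete_edges n)" and k: "k \<ge> 1"
    and t: "t \<le> T" "t \<le> length es"
  shows "2 * card (bought k T es t) \<le> capped_degrees n k (bought k T es t) + late_count k (take t es)"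
  using t
proof (induction t)
  case 0
  then show ?case by simp
next
  case (Suc t)
  define B where "B = bought k T es t"
  define e where "e = es ! t"
  have tl: "t < length es" using Suc by simp
  have e: "e \<subseteq> {1..n}" "card e = 2" "e \<notin> B" using nth_edge[OF es tl] by (auto simp: e_def B_def)
  have late: "late_count k (take (Suc t) es) = late_count k (take t es) + of_bool (late_edge k (set (take t es)) e)"
    using tl by (simp add: take_Suc_conv_app_nth late_count_snoc e_def)
  show ?case
  proof (cases "wants k T t B e")
    case False
    then show ?thesis using Suc late by (simp add: B_def e_def)
  next
    case True
    have "2 \<le> (\<Sum>v\<in>e. of_bool (vertex_degree B v < k)) + (of_bool (late_edge k (set (take t es)) e) :: nat)"
    proof (cases "\<forall>v\<in>e. vertex_degree B v < k")
      case True
      then show ?thesis using e by simp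
    next
      case False
      then obtain v where v: "v \<in> e" "k \<le> vertex_degree B v" by auto
      obtain u where u: "u \<in> e" "vertex_degree B u = 0"
        using \<open>wants k T t B e\<close> False Suc.prems by (auto simp: wants_def)
      have "vertex_degree (set (take t es)) u = 0"
        using touched_bought[OF k, of t es u T] u tl by (auto simp: B_def)
      moreover have "vertex_degree B v \<le> vertex_degree (set (take t es)) v"
        unfolding B_def using tl by (intro vertex_degree_mono bought_subset) auto
      ultimately have "late_edge k (set (take t es)) e" using u v unfolding late_edge_def by (meson order_trans)
      moreover have "(\<Sum>v\<in>e. of_bool (vertex_degree B v < k)) \<ge> (of_bool (vertex_degree B u < k) :: nat)"
        using u e finite_subset by (intro member_le_sum) auto
      ultimately show ?thesis using u k by simp
    qed
    moreover have "bought k T es (Suc t) = insert e B" using True by (simp add: B_def e_def)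
    moreover have "card (insert e B) = Suc (card B)" using e by (simp add: B_def)
    moreover have "capped_degrees n k (insert e B) = capped_degrees n k B + (\<Sum>v\<in>e. of_bool (vertex_degree B v < k))"
      using e by (intro capped_degrees_insert) (auto simp: B_def)
    moreover have "2 * card B \<le> capped_degrees n k B + late_count k (take t es)"
      using Suc by (simp add: B_def)
    ultimately show ?thesis unfolding late by simp
  qed
qed

text \<open>Here a purchase may raise the capped degree sum by only 1, so edges are paid for at up
  to twice the first-phase price. This is tolerable because little is missing at time
  \<open>T\<close>.\<close>

lemma second_phase_count:
  assumes es: "es \<in> permutations_of_set (complete_edges n)" and t: "T \<le> t" "t \<le> length es"
  shows "card (bought k T es t) + capped_degrees n k (bought k T es T)
     \<le> card (bought k T es T) + capped_degrees n k (bought k T es t)"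
  using t
proof (induction t rule: dec_induct)
  case base
  then show ?case by simp
next
  case (step t)
  define B where "B = bought k T es t"
  define e where "e = es ! t"
  have tl: "t < length es" using step by simp
  have e: "e \<subseteq> {1..n}" "card e = 2" "e \<notin> B" using nth_edge[OF es tl] by (auto simp: e_def B_def)
  show ?case
  proof (cases "wants k T t B e")
    case False
    then show ?thesis using step by (simp add: B_def e_def)
  next
    case True
    then obtain u where u: "u \<in> e" "vertex_degree B u < k" using step by (auto simp: wants_def)
    have "(\<Sum>v\<in>e. of_bool (vertex_degree B v < k)) \<ge> (of_bool (vertex_degree B u < k) :: nat)"
      using u e finite_subset by (intro member_le_sum) auto
    moreover have "bought k T es (Suc t) = insert e B" using True by (simp add: B_def e_def)
    moreover have "card (insert e B) = Suc (card B)" using e by (simp add: B_def)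
    moreover have "capped_degrees n k (insert e B) = capped_degrees n k B + (\<Sum>v\<in>e. of_bool (vertex_degree B v < k))"
      using e by (intro capped_degrees_insert) (auto simp: B_def)
    moreover have "card B + capped_degrees n k (bought k T es T) \<le> card (bought k T es T) + capped_degrees n k B"
      using step by (simp add: B_def)
    ultimately show ?thesis using u by simp
  qed
qed

definition deficient :: "nat \<Rightarrow> nat \<Rightarrow> edge set \<Rightarrow> nat set" where
  "deficient n k B = {v \<in> {1..n}. vertex_degree B v < k}"

text \<open>At time \<open>T\<close> each deficient vertex misses at most \<open>k\<close> units of
  capped degree, and the second phase pays at most one edge per missing unit.\<close>

lemma card_bought_le:
  assumes es: "es \<in> permutations_of_set (complete_edges n)" and k: "k \<ge> 1"
    and t: "T \<le> t" "t \<le> length es"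
  shows "2 * card (bought k T es t) \<le>
    k * n + late_count k (take T es) + 2 * k * card (deficient n k (bought k T es T))"
proof -
  define L where "L = deficient n k (bought k T es T)"
  have L: "L \<subseteq> {1..n}" "finite L" by (auto simp: L_def deficient_def)
  have "(\<Sum>v\<in>{1..n} - L. k) \<le> (\<Sum>v\<in>{1..n} - L. min k (vertex_degree (bought k T es T) v))"
    by (intro sum_mono) (auto simp: L_def deficient_def)
  also have "\<dots> \<le> capped_degrees n k (bought k T es T)"
    unfolding capped_degrees_def by (intro sum_mono2) auto
  finally have "k * n \<le> capped_degrees n k (bought k T es T) + k * card L"
    using L by (simp add: card_Diff_subset algebra_simps diff_mult_distrib2)
  moreover have "2 * card (bought k T es T) \<le> k * n + late_count k (take T es)"
    using first_phase_count[OF es k, of T T] t capped_degrees_le[of n k "bought k T es T"] by simp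
  moreover note second_phase_count[OF es t, of k] capped_degrees_le[of n k "bought k T es t"]
  ultimately show ?thesis unfolding L_def[symmetric] by linarith
qed

text \<open>Degrees only grow, so both ends of an edge inside the deficient set were unsaturated
  when it appeared, and it was bought. Each deficient vertex has fewer than \<open>k\<close> bought
  edges. The set is therefore sparse in the random graph itself, which rules out a large
  set.\<close>

lemma deficient_edges:
  assumes es: "es \<in> permutations_of_set (complete_edges n)" and T: "T \<le> length es"
  shows "card {e \<in> set (take T es). e \<subseteq> deficient n k (bought k T es T)} \<le> k * n"
proof -
  define L where "L = deficient n k (bought k T es T)"
  define B where "B = bought k T es T"
  have L: "L \<subseteq> {1..n}" "finite L" by (auto simp: L_def deficient_def)
  have "{e \<in> set (take T es). e \<subseteq> L} \<subseteq> (\<Union>v\<in>L. {e \<in> B. v \<in> e})"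
  proof
    fix e assume "e \<in> {e \<in> set (take T es). e \<subseteq> L}"
    then obtain j where j: "j < T" "e = es ! j" "e \<subseteq> L" using T by (auto simp: in_set_conv_nth)
    have "vertex_degree (bought k T es j) v < k" if "v \<in> e" for v
    proof -
      have "vertex_degree (bought k T es j) v \<le> vertex_degree (bought k T es T) v"
        using j by (intro vertex_degree_mono bought_mono) auto
      also have "\<dots> < k" using that j by (auto simp: L_def deficient_def)
      finally show ?thesis .
    qed
    then have "wants k T j (bought k T es j) (es ! j)" using j by (auto simp: wants_def)
    then have "e \<in> B" unfolding B_def bought_eq[of _ _ _ T] using j by auto
    moreover have "e \<noteq> {}" using nth_edge(2)[OF es, of j] j T by auto
    ultimately show "e \<in> (\<Union>v\<in>L. {e \<in> B. v \<in> e})" using j by auto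
  qed
  then have "card {e \<in> set (take T es). e \<subseteq> L} \<le> card (\<Union>v\<in>L. {e \<in> B. v \<in> e})"
    by (intro card_mono) (auto simp: B_def L)
  also have "\<dots> \<le> (\<Sum>v\<in>L. card {e \<in> B. v \<in> e})" by (rule card_UN_le) (fact L)
  also have "\<dots> \<le> (\<Sum>v\<in>L. k)"
    by (intro sum_mono) (auto simp: L_def deficient_def B_def vertex_degree_def)
  also have "\<dots> \<le> k * n" using card_mono[OF _ L(1)] by (simp add: mult.commute)
  finally show ?thesis by (simp add: L_def)
qed

section \<open>Degrees at the hitting time\<close>

lemma second_phase_degree:
  assumes es: "es \<in> permutations_of_set (complete_edges n)" and t: "T \<le> t" "t \<le> length es"
  shows "min k (vertex_degree (bought k T es T) v + vertex_degree (set (take (t - T) (drop T es))) v)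
    \<le> vertex_degree (bought k T es t) v"
  using t
proof (induction t rule: dec_induct)
  case base
  then show ?case by (simp add: vertex_degree_def)
next
  case (step t)
  define B where "B = bought k T es t"
  define e where "e = es ! t"
  have tl: "t < length es" using step by simp
  have e: "e \<notin> B" "e \<notin> set (take t es)" using nth_edge[OF es tl] by (auto simp: e_def B_def)
  have "take (Suc t - T) (drop T es) = take (t - T) (drop T es) @ [e]"
    using step by (simp add: Suc_diff_le take_Suc_conv_app_nth e_def)
  moreover have "set (take (t - T) (drop T es)) \<subseteq> set (take t es)"
    using step(1) set_drop_subset[of T "take t es"] by (simp add: drop_take)
  ultimately have *: "vertex_degree (set (take (Suc t - T) (drop T es))) v =
     vertex_degree (set (take (t - T) (drop T es))) v + of_bool (v \<in> e)"
    using e by (subst vertex_degree_insert[symmetric]) auto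
  have "vertex_degree B v \<le> vertex_degree (bought k T es (Suc t)) v"
    unfolding B_def by (intro vertex_degree_mono bought_mono) auto
  moreover have "vertex_degree (bought k T es (Suc t)) v = Suc (vertex_degree B v)"
    if "v \<in> e" "vertex_degree B v < k"
  proof -
    have "wants k T t B e" using that step by (auto simp: wants_def)
    then have "bought k T es (Suc t) = insert e B" by (simp add: B_def e_def)
    then show ?thesis using e that by (simp add: vertex_degree_insert B_def)
  qed
  ultimately show ?case using step unfolding * B_def[symmetric] by (cases "v \<in> e \<and> vertex_degree B v < k") auto
qed

text \<open>The window ends at a deterministic time \<open>m\<close> before \<open>t\<close>, which
  makes its degrees accessible to a union bound; \<open>t\<close> will be the random hitting time
  and is used only through \<open>full\<close>. The \<open>Suc\<close> stands for the edge already
  owned by a touched vertex.\<close>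

lemma bought_min_degree:
  assumes es: "es \<in> permutations_of_set (complete_edges n)" and k: "k \<ge> 1"
    and m: "T \<le> m" "m \<le> t" "t \<le> length es"
    and full: "k \<le> vertex_degree (set (take t es)) v"
    and window: "k \<le> Suc (vertex_degree (set (take (m - T) (drop T es))) v)"
  shows "k \<le> vertex_degree (bought k T es t) v"
proof (cases "vertex_degree (set (take T es)) v = 0")
  case True
  have "take t es = take T es @ take (t - T) (drop T es)"
    using m by (metis le_add_diff_inverse order_trans take_add)
  then have "vertex_degree (set (take t es)) v \<le>
      vertex_degree (set (take T es)) v + vertex_degree (set (take (t - T) (drop T es))) v"
    unfolding vertex_degree_def by (simp add: Collect_disj_eq conj_disj_distribR card_Un_le)
  then show ?thesis using second_phase_degree[OF es, of T t k v] m full True by simp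
next
  case False
  then have "vertex_degree (bought k T es T) v > 0" using touched_bought[OF k, of T es v] m by simp
  moreover have "vertex_degree (set (take (m - T) (drop T es))) v \<le> vertex_degree (set (take (t - T) (drop T es))) v"
    using m by (intro vertex_degree_mono set_take_subset_set_take) auto
  ultimately show ?thesis using second_phase_degree[OF es, of T t k v] m window by simp
qed

lemma min_degree_ge_iff:
  assumes "n \<ge> 1"
  shows "k \<le> min_degree n E \<longleftrightarrow> (\<forall>v\<in>{1..n}. k \<le> vertex_degree E v)"
  using assms by (auto simp: min_degree_def)

lemma hitting_time_props:
  assumes es: "es \<in> permutations_of_set (complete_edges n)" and n: "n > k"
  shows "hitting_time n k es \<le> length es"
    "v \<in> {1..n} \<Longrightarrow> k \<le> vertex_degree (set (take (hitting_time n k es) es)) v"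
    "v \<in> {1..n} \<Longrightarrow> vertex_degree (set (take m es)) v < k \<Longrightarrow> m < hitting_time n k es"
proof -
  define M where "M = {m. k \<le> min_degree n (process_graph es m)}"
  have M: "m \<in> M \<longleftrightarrow> (\<forall>v\<in>{1..n}. k \<le> vertex_degree (set (take m es)) v)" for m
    using n by (simp add: M_def min_degree_ge_iff process_graph_def)
  \<comment> \<open>For \<open>n > k\<close> the complete graph has minimum degree n - 1, at least
    \<open>k\<close>, so the infimum is attained and is not the default value of an empty
    infimum.\<close>
  have "length es \<in> M"
    using card_star[of _ n] n edge_orderD(2)[OF es] by (auto simp: M vertex_degree_def)
  then have in_M: "Inf M \<in> M" and le: "Inf M \<le> length es"
    by (auto intro: Inf_nat_def1 cInf_lower)
  show "hitting_time n k es \<le> length es"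
    using le by (simp add: hitting_time_def M_def)
  have *: "hitting_time n k es = Inf M" by (simp add: hitting_time_def M_def)
  show ge: "k \<le> vertex_degree (set (take (hitting_time n k es) es)) v" if "v \<in> {1..n}" for v
    using in_M M that by (simp add: *)
  show "m < hitting_time n k es" if v: "v \<in> {1..n}" "vertex_degree (set (take m es)) v < k"
  proof (rule ccontr)
    assume "\<not> ?thesis"
    then have "vertex_degree (set (take (hitting_time n k es) es)) v \<le> vertex_degree (set (take m es)) v"
      by (intro vertex_degree_mono set_take_subset_set_take) auto
    then show False using ge[of v] v by simp
  qed
qed

section \<open>Sparse sets and low degrees in a window\<close>

lemma perm_avg_Bex_le:
  assumes "finite X"
  shows "perm_avg A (\<lambda>es. of_bool (\<exists>x\<in>X. P x es)) \<le> (\<Sum>x\<in>X. perm_avg A (\<lambda>es. of_bool (P x es)))"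
proof -
  have "perm_avg A (\<lambda>es. of_bool (\<exists>x\<in>X. P x es)) \<le> perm_avg A (\<lambda>es. \<Sum>x\<in>X. of_bool (P x es))"
  proof (rule perm_avg_mono)
    fix es
    show "of_bool (\<exists>x\<in>X. P x es) \<le> (\<Sum>x\<in>X. of_bool (P x es) :: real)"
    proof (cases "\<exists>x\<in>X. P x es")
      case True
      then obtain x where "x \<in> X" "P x es" by auto
      then show ?thesis
        using member_le_sum[of x X "\<lambda>x. of_bool (P x es) :: real"] assms by auto
    qed (auto intro: sum_nonneg)
  qed
  then show ?thesis by (simp add: perm_avg_sum)
qed

text \<open>A large sparse set contains a sparse set of size exactly \<open>l\<close>. There are at
  most \<open>2 ^ n\<close> such sets, and each is handled by \<open>prefix_hits_le\<close> with
  \<open>z = 1 / 2\<close>.\<close>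

lemma sparse_subset_bound:
  assumes m: "m \<le> n choose 2" and j: "j \<le> l choose 2" and l: "l \<le> n"
  shows "perm_avg (complete_edges n) (\<lambda>es. of_bool (\<exists>L\<subseteq>{1..n}. l \<le> card L \<and> card {e \<in> set (take m es). e \<subseteq> L} \<le> j))
    \<le> 2 ^ n * (2 ^ j * (1 - (1 / 2) * real ((l choose 2) - j) / real (n choose 2)) ^ m)"
proof -
  define X where "X = {L. L \<subseteq> {1..n} \<and> card L = l}"
  have fin: "finite X" by (simp add: X_def)
  have "perm_avg (complete_edges n) (\<lambda>es. of_bool (\<exists>L\<subseteq>{1..n}. l \<le> card L \<and> card {e \<in> set (take m es). e \<subseteq> L} \<le> j))
    \<le> perm_avg (complete_edges n) (\<lambda>es. of_bool (\<exists>L\<in>X. card (set (take m es) \<inter> {e \<in> complete_edges n. e \<subseteq> L}) \<le> j))"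
  proof (rule perm_avg_mono)
    fix es assume es: "es \<in> permutations_of_set (complete_edges n)"
    have "\<exists>L\<in>X. card (set (take m es) \<inter> {e \<in> complete_edges n. e \<subseteq> L}) \<le> j"
      if L: "L \<subseteq> {1..n}" "l \<le> card L" "card {e \<in> set (take m es). e \<subseteq> L} \<le> j" for L
    proof -
      obtain L' where L': "L' \<subseteq> L" "card L' = l" using obtain_subset_with_card_n[OF L(2)] by metis
      have "card (set (take m es) \<inter> {e \<in> complete_edges n. e \<subseteq> L'}) \<le> card {e \<in> set (take m es). e \<subseteq> L}"
        using L' by (intro card_mono) auto
      then show ?thesis using L L' by (intro bexI[of _ L']) (auto simp: X_def)
    qed
    then show "of_bool (\<exists>L\<subseteq>{1..n}. l \<le> card L \<and> card {e \<in> set (take m es). e \<subseteq> L} \<le> j)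
      \<le> (of_bool (\<exists>L\<in>X. card (set (take m es) \<inter> {e \<in> complete_edges n. e \<subseteq> L}) \<le> j) :: real)"
      by auto
  qed
  also have "\<dots> \<le> (\<Sum>L\<in>X. perm_avg (complete_edges n)
      (\<lambda>es. of_bool (card (set (take m es) \<inter> {e \<in> complete_edges n. e \<subseteq> L}) \<le> j)))"
    by (rule perm_avg_Bex_le) (fact fin)
  also have "\<dots> \<le> (\<Sum>L\<in>X. 2 ^ j * (1 - (1 / 2) * real ((l choose 2) - j) / real (n choose 2)) ^ m)"
  proof (rule sum_mono)
    fix L assume L: "L \<in> X"
    have fL: "finite L" using L finite_subset by (auto simp: X_def)
    have "{e \<in> complete_edges n. e \<subseteq> L} = {e. e \<subseteq> L \<and> card e = 2}"
      using L by (auto simp: X_def complete_edges_def)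
    then have c: "card {e \<in> complete_edges n. e \<subseteq> L} = l choose 2"
      using n_subsets[OF fL, of 2] L by (simp add: X_def)
    show "perm_avg (complete_edges n) (\<lambda>es. of_bool (card (set (take m es) \<inter> {e \<in> complete_edges n. e \<subseteq> L}) \<le> j))
       \<le> 2 ^ j * (1 - (1 / 2) * real ((l choose 2) - j) / real (n choose 2)) ^ m"
      using prefix_hits_le[of "complete_edges n" "{e \<in> complete_edges n. e \<subseteq> L}" "1 / 2" j m] m j
      by (simp add: c card_complete_edges)
  qed
  also have "\<dots> = card X * (2 ^ j * (1 - (1 / 2) * real ((l choose 2) - j) / real (n choose 2)) ^ m)" by simp
  also have "\<dots> \<le> 2 ^ n * (2 ^ j * (1 - (1 / 2) * real ((l choose 2) - j) / real (n choose 2)) ^ m)"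
  proof (rule mult_right_mono)
    have "card X \<le> card (Pow {1..n})" by (intro card_mono) (auto simp: X_def)
    then have "card X \<le> 2 ^ n" by (simp add: card_Pow)
    then show "real (card X) \<le> 2 ^ n" by (metis of_nat_le_iff of_nat_numeral of_nat_power)
    have "l choose 2 \<le> n choose 2" using l by (intro binomial_right_mono)
    then have "real ((l choose 2) - j) \<le> real (n choose 2)" by linarith
    then have "(1 / 2) * real ((l choose 2) - j) / real (n choose 2) \<le> 1" by (simp add: divide_le_eq)
    then show "0 \<le> 2 ^ j * (1 - (1 / 2) * real ((l choose 2) - j) / real (n choose 2)) ^ m" by simp
  qed
  finally show ?thesis .
qed

text \<open>Rotation turns the window into a prefix without wrapping around, as \<open>m\<close> is
  at most the number of edges. The hits counted are those in the star of a vertex, which has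
  \<open>n - 1\<close> edges. The parameter \<open>z\<close> is left open because the asymptotics
  need a value tending to 0.\<close>

lemma window_degree_bound:
  fixes z :: real
  assumes T: "T \<le> m" "m \<le> n choose 2" "T < n choose 2" and j: "j \<le> n - 1" and z: "0 < z" "z \<le> 1"
  shows "perm_avg (complete_edges n) (\<lambda>es. of_bool (\<exists>v\<in>{1..n}. vertex_degree (set (take (m - T) (drop T es))) v \<le> j))
    \<le> n * ((1 / z) ^ j * (1 - (1 - z) * real (n - 1 - j) / real (n choose 2)) ^ (m - T))"
proof -
  let ?b = "(1 / z) ^ j * (1 - (1 - z) * real (n - 1 - j) / real (n choose 2)) ^ (m - T)"
  have "perm_avg (complete_edges n) (\<lambda>es. of_bool (\<exists>v\<in>{1..n}. vertex_degree (set (take (m - T) (drop T es))) v \<le> j))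
    = perm_avg (complete_edges n) (\<lambda>es. of_bool (\<exists>v\<in>{1..n}.
         card (set (take (m - T) (rotate T es)) \<inter> {e \<in> complete_edges n. v \<in> e}) \<le> j))"
  proof (rule perm_avg_cong)
    fix es assume es: "es \<in> permutations_of_set (complete_edges n)"
    have "take (m - T) (rotate T es) = take (m - T) (drop T es)"
      using T edge_orderD(3)[OF es] by (simp add: rotate_drop_take)
    moreover have "set (take (m - T) (drop T es)) \<inter> {e \<in> complete_edges n. v \<in> e} =
       {e \<in> set (take (m - T) (drop T es)). v \<in> e}" for v
      using edge_orderD(2)[OF es] by (auto dest: in_set_takeD in_set_dropD)
    ultimately show "of_bool (\<exists>v\<in>{1..n}. vertex_degree (set (take (m - T) (drop T es))) v \<le> j) =
      (of_bool (\<exists>v\<in>{1..n}. card (set (take (m - T) (rotate T es)) \<inter> {e \<in> complete_edges n. v \<in> e}) \<le> j) :: real)"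
      by (simp add: vertex_degree_def)
  qed
  also have "\<dots> = perm_avg (complete_edges n) (\<lambda>es. of_bool (\<exists>v\<in>{1..n}.
         card (set (take (m - T) es) \<inter> {e \<in> complete_edges n. v \<in> e}) \<le> j))"
    by (rule perm_avg_rotate) simp
  also have "\<dots> \<le> (\<Sum>v\<in>{1..n}. perm_avg (complete_edges n) (\<lambda>es. of_bool
         (card (set (take (m - T) es) \<inter> {e \<in> complete_edges n. v \<in> e}) \<le> j)))"
    by (rule perm_avg_Bex_le) simp
  also have "\<dots> \<le> (\<Sum>v\<in>{1..n}. ?b)"
  proof (rule sum_mono)
    fix v assume v: "v \<in> {1..n}"
    show "perm_avg (complete_edges n) (\<lambda>es. of_bool
         (card (set (take (m - T) es) \<inter> {e \<in> complete_edges n. v \<in> e}) \<le> j)) \<le> ?b"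
      using prefix_hits_le[of "complete_edges n" "{e \<in> complete_edges n. v \<in> e}" z j "m - T"] z j T
      unfolding card_star[OF v] card_complete_edges by auto
  qed
  finally show ?thesis by simp
qed

section \<open>Prefixes as uniform random sets\<close>

text \<open>The order within the prefix is irrelevant, so probabilities become quotients of binomial
  coefficients. The inductive step counts in two ways the pairs of a set and a distinguished last
  element.\<close>

lemma perm_avg_prefix_set:
  assumes "finite A" "m \<le> card A"
  shows "perm_avg A (\<lambda>es. f (set (take m es))) = (\<Sum>S | S \<subseteq> A \<and> card S = m. f S) / (card A choose m)"
  using assms(2)
proof (induction m arbitrary: f)
  case 0
  have "{S. S \<subseteq> A \<and> card S = 0} = {{}}" by (auto simp: card_eq_0_iff finite_subset[OF _ assms(1)])
  then show ?case by (simp add: perm_avg_const assms)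
next
  case (Suc m)
  have fin: "finite {S. S \<subseteq> A \<and> card S = i}" for i using assms(1) by simp
  have finS: "finite S" if "S \<subseteq> A" for S using that assms(1) finite_subset by auto
  have "perm_avg A (\<lambda>es. f (set (take (Suc m) es))) =
    perm_avg A (\<lambda>es. (\<lambda>S. (\<Sum>x\<in>A - S. f (insert x S)) / (card A - m)) (set (take m es)))"
    using Suc.prems perm_avg_prefix_Suc[OF assms(1), of m "\<lambda>xs. f (set xs)"] by simp
  also have "\<dots> = (\<Sum>S | S \<subseteq> A \<and> card S = m. (\<Sum>x\<in>A - S. f (insert x S)) / (card A - m)) / (card A choose m)"
    using Suc.prems by (intro Suc.IH) auto
  also have "(\<Sum>S | S \<subseteq> A \<and> card S = m. (\<Sum>x\<in>A - S. f (insert x S)) / (card A - m)) =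
     (\<Sum>(S, x)\<in>Sigma {S. S \<subseteq> A \<and> card S = m} (\<lambda>S. A - S). f (insert x S)) / (card A - m)"
    using fin assms(1) by (simp add: sum.Sigma sum_divide_distrib[symmetric])
  also have "(\<Sum>(S, x)\<in>Sigma {S. S \<subseteq> A \<and> card S = m} (\<lambda>S. A - S). f (insert x S)) =
     (\<Sum>(S, x)\<in>Sigma {S. S \<subseteq> A \<and> card S = Suc m} (\<lambda>S. S). f S)"
    by (rule sum.reindex_bij_witness[where i = "\<lambda>(S, x). (S - {x}, x)" and j = "\<lambda>(S, x). (insert x S, x)"])
       (auto simp: finS insert_absorb)
  also have "\<dots> = (\<Sum>S | S \<subseteq> A \<and> card S = Suc m. \<Sum>x\<in>S. f S)"
    using fin finS by (subst sum.Sigma) auto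
  also have "\<dots> = Suc m * (\<Sum>S | S \<subseteq> A \<and> card S = Suc m. f S)"
    by (simp add: sum_distrib_left)
  also have "Suc m * (\<Sum>S | S \<subseteq> A \<and> card S = Suc m. f S) / (card A - m) / (card A choose m) =
     (\<Sum>S | S \<subseteq> A \<and> card S = Suc m. f S) / (card A choose Suc m)"
  proof -
    have "Suc m * (card A choose Suc m) = (card A - m) * (card A choose m)"
      by (metis binomial_absorb_comp binomial_absorption)
    then have "real (Suc m) * (card A choose Suc m) = real (card A - m) * (card A choose m)"
      by (metis of_nat_mult)
    moreover have "card A choose m > 0" "card A choose Suc m > 0" "card A - m > 0" using Suc.prems by auto
    ultimately show ?thesis by (simp add: divide_simps)
  qed
  finally show ?case .
qed

text \<open>The choices inside \<open>F\<close> and inside \<open>R\<close> are independent once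
  their sizes are fixed. The predicate \<open>Q\<close> on the second part allows the splitting to
  be iterated, as needed for two stars.\<close>

lemma card_subsets_split:
  assumes fin: "finite F" "finite R" and disj: "F \<inter> R = {}" and j: "j \<le> m"
  shows "card {S. S \<subseteq> F \<union> R \<and> card S = m \<and> card (S \<inter> F) = j \<and> Q (S \<inter> R)} =
    (card F choose j) * card {S. S \<subseteq> R \<and> card S = m - j \<and> Q S}"
proof -
  have "bij_betw (\<lambda>(X, Y). X \<union> Y) ({X. X \<subseteq> F \<and> card X = j} \<times> {S. S \<subseteq> R \<and> card S = m - j \<and> Q S})
     {S. S \<subseteq> F \<union> R \<and> card S = m \<and> card (S \<inter> F) = j \<and> Q (S \<inter> R)}"
  proof (rule bij_betw_byWitness[where f' = "\<lambda>S. (S \<inter> F, S \<inter> R)"])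
    show "\<forall>a\<in>{X. X \<subseteq> F \<and> card X = j} \<times> {S. S \<subseteq> R \<and> card S = m - j \<and> Q S}.
       (\<lambda>S. (S \<inter> F, S \<inter> R)) ((\<lambda>(X, Y). X \<union> Y) a) = a" using disj by auto
    show "\<forall>a'\<in>{S. S \<subseteq> F \<union> R \<and> card S = m \<and> card (S \<inter> F) = j \<and> Q (S \<inter> R)}.
       (\<lambda>(X, Y). X \<union> Y) ((\<lambda>S. (S \<inter> F, S \<inter> R)) a') = a'" by auto
    show "(\<lambda>(X, Y). X \<union> Y) ` ({X. X \<subseteq> F \<and> card X = j} \<times> {S. S \<subseteq> R \<and> card S = m - j \<and> Q S})
      \<subseteq> {S. S \<subseteq> F \<union> R \<and> card S = m \<and> card (S \<inter> F) = j \<and> Q (S \<inter> R)}"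
    proof (rule image_subsetI)
      fix a assume "a \<in> {X. X \<subseteq> F \<and> card X = j} \<times> {S. S \<subseteq> R \<and> card S = m - j \<and> Q S}"
      then obtain X Y where a: "a = (X, Y)" and XY: "X \<subseteq> F" "Y \<subseteq> R" "card X = j" "card Y = m - j" "Q Y"
        by auto
      then have "(X \<union> Y) \<inter> F = X" "(X \<union> Y) \<inter> R = Y" using disj by auto
      moreover have "card (X \<union> Y) = card X + card Y"
        using XY disj fin by (intro card_Un_disjoint) (auto intro: finite_subset)
      ultimately show "(\<lambda>(X, Y). X \<union> Y) a \<in>
          {S. S \<subseteq> F \<union> R \<and> card S = m \<and> card (S \<inter> F) = j \<and> Q (S \<inter> R)}"
        using a XY j by auto
    qed
    show "(\<lambda>S. (S \<inter> F, S \<inter> R)) ` {S. S \<subseteq> F \<union> R \<and> card S = m \<and> card (S \<inter> F) = j \<and> Q (S \<inter> R)}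
       \<subseteq> {X. X \<subseteq> F \<and> card X = j} \<times> {S. S \<subseteq> R \<and> card S = m - j \<and> Q S}"
    proof (rule image_subsetI)
      fix S assume S: "S \<in> {S. S \<subseteq> F \<union> R \<and> card S = m \<and> card (S \<inter> F) = j \<and> Q (S \<inter> R)}"
      have "card ((S \<inter> F) \<union> (S \<inter> R)) = card (S \<inter> F) + card (S \<inter> R)"
        using disj fin by (intro card_Un_disjoint) auto
      moreover have "(S \<inter> F) \<union> (S \<inter> R) = S" using S by auto
      ultimately show "(S \<inter> F, S \<inter> R) \<in> {X. X \<subseteq> F \<and> card X = j} \<times> {S. S \<subseteq> R \<and> card S = m - j \<and> Q S}"
        using S by auto
    qed
  qed
  from bij_betw_same_card[OF this] show ?thesis using n_subsets[OF fin(1), of j] by (simp add: card_cartesian_product)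
qed

text \<open>The product is the probability that a uniform \<open>m\<close>-subset of
  \<open>N\<close> elements avoids \<open>b\<close> given ones.\<close>

lemma choose_remove:
  assumes "b + m \<le> N"
  shows "real (N - b choose m) = (N choose m) * (\<Prod>i<b. (real N - real m - real i) / (real N - real i))"
  using assms
proof (induction b)
  case (Suc b)
  have "(N - b - m) * (N - b choose m) = (N - b) * (N - Suc b choose m)"
    using binomial_absorb_comp[of "N - b" m] Suc.prems by (simp add: Suc_diff_Suc)
  then have "real (N - b - m) * (N - b choose m) = real (N - b) * (N - Suc b choose m)"
    by (metis of_nat_mult)
  then have "(real N - m - b) * real (N - b choose m) = (real N - b) * real (N - Suc b choose m)"
    using Suc.prems by (simp add: of_nat_diff algebra_simps)
  then have "real (N - Suc b choose m) = (N - b choose m) * ((real N - m - b) / (real N - b))"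
    using Suc.prems by (simp add: field_simps)
  then show ?case using Suc by simp
qed simp

text \<open>The product is the probability that a uniform \<open>m\<close>-subset of
  \<open>M\<close> elements contains \<open>i\<close> given ones.\<close>

lemma choose_remove_both:
  assumes "i \<le> m" "m \<le> M"
  shows "real (M - i choose (m - i)) = (M choose m) * (\<Prod>l<i. (real m - real l) / (real M - real l))"
  using assms
proof (induction i)
  case (Suc i)
  have "Suc (m - Suc i) * (Suc (M - Suc i) choose Suc (m - Suc i)) = Suc (M - Suc i) * (M - Suc i choose (m - Suc i))"
    by (simp only: Suc_times_binomial)
  then have "(m - i) * (M - i choose (m - i)) = (M - i) * (M - Suc i choose (m - Suc i))"
    using Suc.prems by (simp add: Suc_diff_Suc)
  then have "real (m - i) * (M - i choose (m - i)) = real (M - i) * (M - Suc i choose (m - Suc i))"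
    by (metis of_nat_mult)
  then have "(real m - i) * real (M - i choose (m - i)) = (real M - i) * real (M - Suc i choose (m - Suc i))"
    using Suc.prems by (simp add: of_nat_diff)
  then have "real (M - Suc i choose (m - Suc i)) = (M - i choose (m - i)) * ((real m - i) / (real M - i))"
    using Suc.prems by (simp add: field_simps)
  then show ?case using Suc by simp
qed simp

section \<open>Second moment of the number of low-degree vertices\<close>

definition degree_prob :: "nat \<Rightarrow> nat \<Rightarrow> nat \<Rightarrow> nat \<Rightarrow> real" where
  "degree_prob N a m j = real ((a choose j) * (N - a choose (m - j))) / real (N choose m)"

text \<open>Bounds the ratio of a joint degree probability to the product of the single ones. The
  first factor pays for the edge shared by two stars, the second for replacing
  \<open>m / (N - 2 a)\<close> by \<open>(m - j) / N\<close> at each of the \<open>2 * j\<close>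
  present edges.\<close>

definition correlation :: "nat \<Rightarrow> nat \<Rightarrow> nat \<Rightarrow> nat \<Rightarrow> real" where
  "correlation N a m j =
     (real N / (real N - real m - real a)) * (real m * real N / ((real m - real j) * (real N - 2 * real a))) ^ (2 * j)"

lemma avoid_prod_pos:
  assumes "b + m < N"
  shows "0 < (\<Prod>i<b. (real N - real m - real i) / (real N - real i))"
  using assms by (intro prod_pos) auto

text \<open>Of the \<open>a\<close> star edges, \<open>a - j\<close> given ones are avoided, with
  probability \<open>r\<close>, and the other \<open>j\<close> are contained, each at a factor of at
  least \<open>(m - j) / N\<close>.\<close>

lemma degree_prob_lower:
  assumes jm: "j \<le> m" and ja: "j \<le> a" and am: "2 * a + m < N"
  defines "r \<equiv> (\<Prod>i<a - j. (real N - real m - real i) / (real N - real i))"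
  shows "(a choose j) * (r * ((real m - real j) / real N) ^ j) \<le> degree_prob N a m j"
proof -
  have c: "N choose m > 0" using am by simp
  have Na: "N - a = N - (a - j) - j" using ja am by simp
  have "real (N - a choose (m - j)) = (N - (a - j) choose m) * (\<Prod>l<j. (real m - real l) / (real (N - (a - j)) - real l))"
    unfolding Na using jm am by (intro choose_remove_both) auto
  also have "real (N - (a - j) choose m) = (N choose m) * r"
    unfolding r_def using am by (intro choose_remove) auto
  finally have "real (N - a choose (m - j)) / (N choose m) = r * (\<Prod>l<j. (real m - real l) / (real (N - (a - j)) - real l))"
    using c by simp
  also have "\<dots> \<ge> r * (\<Prod>l<j. (real m - real j) / real N)"
  proof (intro mult_left_mono prod_mono conjI)
    fix l assume "l \<in> {..<j}"
    then show "(real m - real j) / real N \<le> (real m - real l) / (real (N - (a - j)) - real l)"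
      using jm ja am by (intro frac_le) (auto simp: of_nat_diff)
    show "0 \<le> (real m - real j) / real N" using jm by simp
  next
    show "0 \<le> r" unfolding r_def using am by (intro less_imp_le avoid_prod_pos) auto
  qed
  finally have "r * ((real m - real j) / real N) ^ j \<le> real (N - a choose (m - j)) / (N choose m)" by simp
  then have "(a choose j) * (r * ((real m - real j) / real N) ^ j) \<le> (a choose j) * (real (N - a choose (m - j)) / (N choose m))"
    by (intro mult_left_mono) auto
  then show ?thesis by (simp add: degree_prob_def)
qed

text \<open>The left-hand side is the probability that two vertices have degree \<open>j\<close> and
  are not adjacent: of the \<open>2 * a - 1\<close> edges in the union of their stars,
  \<open>2 * j\<close> are present and \<open>2 * b - 1\<close> absent.\<close>

lemma joint_degree_le:
  assumes jm: "2 * j \<le> m" "j < m" and ja: "j < a" and am: "2 * a + m < N"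
  shows "real ((a - 1 choose j) * ((a - 1 choose j) * (N - (2 * a - 1) choose (m - 2 * j)))) / real (N choose m)
    \<le> correlation N a m j * (degree_prob N a m j)\<^sup>2"
proof -
  define b where "b = a - j"
  define g where "g = (\<lambda>i. (real N - real m - real i) / (real N - real i))"
  define r where "r = (\<lambda>b. \<Prod>i<b. g i)"
  have b: "b \<ge> 1" "b \<le> a" "2 * b - 1 = b + (b - 1)" "2 * a - 1 = 2 * j + (2 * b - 1)"
    using ja by (auto simp: b_def)
  have bS: "b = Suc (b - 1)" using b(1) by simp
  have c: "N choose m > 0" using am by simp
  have g0: "0 < g i" "g i \<le> 1" if "i \<le> 2 * a" for i using that am by (auto simp: g_def)
  have rpos: "0 < r i" if "i \<le> 2 * a" for i unfolding r_def using that g0 by (intro prod_pos) auto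
  have Na: "N - (2 * a - 1) = N - (2 * b - 1) - 2 * j" using b(4) by simp
  have "real (N - (2 * a - 1) choose (m - 2 * j)) = (N - (2 * b - 1) choose m) *
      (\<Prod>l<2 * j. (real m - real l) / (real (N - (2 * b - 1)) - real l))"
    unfolding Na using jm am b(1,2) by (intro choose_remove_both) linarith+
  also have "real (N - (2 * b - 1) choose m) = (N choose m) * r (2 * b - 1)"
    unfolding r_def g_def using am b by (intro choose_remove) auto
  finally have "real (N - (2 * a - 1) choose (m - 2 * j)) / (N choose m) =
      r (2 * b - 1) * (\<Prod>l<2 * j. (real m - real l) / (real (N - (2 * b - 1)) - real l))"
    using c by simp
  also have "\<dots> \<le> r (2 * b - 1) * (\<Prod>l<2 * j. real m / (real N - 2 * real a))"
  proof (intro mult_left_mono prod_mono conjI)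
    fix l assume l: "l \<in> {..<2 * j}"
    have N: "real (N - (2 * b - 1)) = real N - 2 * real b + 1" using b am by (simp add: of_nat_diff)
    show "(real m - real l) / (real (N - (2 * b - 1)) - real l) \<le> real m / (real N - 2 * real a)"
      unfolding N using l jm b am ja by (intro frac_le) (auto simp: b_def of_nat_diff)
    show "0 \<le> (real m - real l) / (real (N - (2 * b - 1)) - real l)"
      unfolding N using l jm b am ja by (intro divide_nonneg_nonneg) (auto simp: b_def of_nat_diff)
  next
    have "2 * b - 1 \<le> 2 * a" using b(2) by linarith
    from rpos[OF this] show "0 \<le> r (2 * b - 1)" by (rule less_imp_le)
  qed
  finally have Y: "real (N - (2 * a - 1) choose (m - 2 * j)) / (N choose m)
     \<le> r (2 * b - 1) * (real m / (real N - 2 * real a)) ^ (2 * j)" by simp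
  have r_split: "r (2 * b - 1) \<le> r b * (r b * (real N / (real N - real m - real a)))"
  proof -
    have "r (2 * b - 1) = r b * (\<Prod>i<b - 1. g (b + i))"
      unfolding r_def b(3) lessThan_atLeast0
      by (subst prod.atLeastLessThan_concat[symmetric, of 0 b "b + (b - 1)"])
         (auto simp: prod.atLeastLessThan_shift_0[of _ b] simp flip: atLeast0LessThan)
    \<comment> \<open>The avoidance factors decrease along the product, so a later block is at most
      an initial block of the same length.\<close>
    also have "(\<Prod>i<b - 1. g (b + i)) \<le> r (b - 1)"
      unfolding r_def
    proof (intro prod_mono conjI)
      fix i assume i: "i \<in> {..<b - 1}"
      have "b + i \<le> 2 * a" using i b(2) by simp
      from g0(1)[OF this] show "0 \<le> g (b + i)" by simp
      have "g i' = 1 - real m / (real N - real i')" if "i' \<le> 2 * a" for i'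
        using that am by (simp add: g_def field_simps)
      moreover have "real m / (real N - real i) \<le> real m / (real N - real (b + i))"
        using i b am by (intro divide_left_mono) auto
      ultimately show "g (b + i) \<le> g i" using i b by simp
    qed
    \<comment> \<open>The common edge is counted once, not twice, so one factor is missing for a
      full square; it is at least the reciprocal of the correction.\<close>
    also have "r (b - 1) \<le> r b * (real N / (real N - real m - real a))"
    proof -
      have "r b = r (b - 1) * g (b - 1)" using bS by (metis r_def prod.lessThan_Suc)
      moreover have "g (b - 1) * (real N / (real N - real m - real a)) \<ge> 1"
      proof -
        have "(real N - real m - real a) / real N \<le> g (b - 1)"
          unfolding g_def using b am by (intro frac_le) (auto simp: of_nat_diff)
        then show ?thesis using am by (simp add: field_simps)
      qed
      moreover have "b - 1 \<le> 2 * a" using b(2) by linarith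
      from rpos[OF this] have "0 \<le> r (b - 1)" by (rule less_imp_le)
      ultimately show ?thesis using mult_left_mono[of 1 "g (b - 1) * (real N / (real N - real m - real a))" "r (b - 1)"]
        by (metis mult.assoc mult.right_neutral)
    qed
    finally show ?thesis using rpos[of b] b by simp
  qed
  define p where "p = degree_prob N a m j"
  have "real ((a - 1 choose j) * ((a - 1 choose j) * (N - (2 * a - 1) choose (m - 2 * j)))) / real (N choose m)
    = (real (a - 1 choose j))\<^sup>2 * (real (N - (2 * a - 1) choose (m - 2 * j)) / (N choose m))"
    by (simp add: power2_eq_square)
  also have "\<dots> \<le> (real (a choose j))\<^sup>2 *
     ((r b * (r b * (real N / (real N - real m - real a)))) * (real m / (real N - 2 * real a)) ^ (2 * j))"
  proof (intro mult_mono power_mono)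
    show "real (a - 1 choose j) \<le> real (a choose j)" using binomial_right_mono[of "a - 1" a j] by simp
    show "real (N - (2 * a - 1) choose (m - 2 * j)) / (N choose m)
       \<le> (r b * (r b * (real N / (real N - real m - real a)))) * (real m / (real N - 2 * real a)) ^ (2 * j)"
      using am by (intro order.trans[OF Y] mult_right_mono r_split) auto
  qed auto
  also have "\<dots> = correlation N a m j * ((a choose j) * (r b * ((real m - real j) / real N) ^ j))\<^sup>2"
  proof -
    have x: "(real m / (real N - 2 * real a)) ^ (2 * j) =
      (real m * real N / ((real m - real j) * (real N - 2 * real a))) ^ (2 * j) * (((real m - real j) / real N) ^ j)\<^sup>2"
    proof -
      have "real m * real N / ((real m - real j) * (real N - 2 * real a)) * ((real m - real j) / real N)
          = real m / (real N - 2 * real a)"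
        using jm am by simp
      then show ?thesis unfolding power_even_eq[symmetric] power_mult_distrib[symmetric] by simp
    qed
    show ?thesis unfolding correlation_def x by (simp add: power2_eq_square)
  qed
  also have "\<dots> \<le> correlation N a m j * p\<^sup>2"
  proof (intro mult_left_mono power_mono)
    show "(a choose j) * (r b * ((real m - real j) / real N) ^ j) \<le> p"
      unfolding p_def r_def g_def b_def using jm ja am by (intro degree_prob_lower) auto
    show "0 \<le> (a choose j) * (r b * ((real m - real j) / real N) ^ j)"
      using jm rpos[of b] b by simp
    show "0 \<le> correlation N a m j" using jm am by (simp add: correlation_def)
  qed
  finally show ?thesis by (simp add: p_def)
qed

lemma prefix_prob:
  assumes "finite A" "m \<le> card A"
  shows "perm_avg A (\<lambda>es. of_bool (Q (set (take m es)))) = card {S. S \<subseteq> A \<and> card S = m \<and> Q S} / (card A choose m)"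
proof -
  have "{S. S \<subseteq> A \<and> card S = m} \<inter> Collect Q = {S. S \<subseteq> A \<and> card S = m \<and> Q S}" by auto
  then show ?thesis using perm_avg_prefix_set[OF assms, of "\<lambda>S. of_bool (Q S)"] assms by simp
qed

lemma prob_degree_eq:
  assumes v: "v \<in> {1..n}" and m: "m \<le> n choose 2" and j: "j \<le> m"
  shows "perm_avg (complete_edges n) (\<lambda>es. of_bool (vertex_degree (set (take m es)) v = j))
     = degree_prob (n choose 2) (n - 1) m j"
proof -
  define F where "F = {e \<in> complete_edges n. v \<in> e}"
  define R where "R = complete_edges n - F"
  have FR: "complete_edges n = F \<union> R" "F \<inter> R = {}" "finite F" "finite R" by (auto simp: F_def R_def)
  have cF: "card F = n - 1" unfolding F_def by (rule card_star) (fact v)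
  have cR: "card R = (n choose 2) - (n - 1)"
    unfolding R_def cF[symmetric] card_complete_edges[symmetric] using FR by (intro card_Diff_subset) (auto simp: F_def)
  have "{S. S \<subseteq> complete_edges n \<and> card S = m \<and> vertex_degree S v = j} =
     {S. S \<subseteq> F \<union> R \<and> card S = m \<and> card (S \<inter> F) = j \<and> True}"
  proof -
    have "vertex_degree S v = card (S \<inter> F)" if "S \<subseteq> complete_edges n" for S
      unfolding vertex_degree_def using that by (intro arg_cong[of _ _ card]) (auto simp: F_def)
    then show ?thesis unfolding FR(1)[symmetric] by auto
  qed
  also have "card \<dots> = (card F choose j) * card {S. S \<subseteq> R \<and> card S = m - j \<and> True}"
    using card_subsets_split[OF FR(3,4,2) j, where Q = "\<lambda>_. True"] .
  also have "\<dots> = (n - 1 choose j) * ((n choose 2) - (n - 1) choose (m - j))"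
    using n_subsets[OF FR(4), of "m - j"] by (simp add: cF cR)
  finally show ?thesis
    using m by (simp add: prefix_prob[of _ _ "\<lambda>S. vertex_degree S v = j"] card_complete_edges degree_prob_def)
qed

text \<open>If the edge \<open>uv\<close> is absent, the two stars are disjoint and the joint probability is explicit.
  If it is present, the two stars together contain at most \<open>2 j - 1\<close> edges, which is unlikely.\<close>

lemma prob_degrees_eq:
  fixes z :: real
  assumes uv: "u \<in> {1..n}" "v \<in> {1..n}" "u \<noteq> v" and m: "2 * j \<le> m" "j < m" "2 * (n - 1) + m < n choose 2"
    and j: "1 \<le> j" "j < n - 1" and z: "0 < z" "z \<le> 1"
  shows "perm_avg (complete_edges n) (\<lambda>es. of_bool (vertex_degree (set (take m es)) u = j \<and> vertex_degree (set (take m es)) v = j))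
     \<le> correlation (n choose 2) (n - 1) m j * (degree_prob (n choose 2) (n - 1) m j)\<^sup>2 +
       (1 / z) ^ (2 * j - 1) * (1 - (1 - z) * real (2 * (n - 1 - j)) / real (n choose 2)) ^ m"
proof -
  define K where "K = complete_edges n"
  define e where "e = {u, v}"
  define F G where "F = {e' \<in> K. u \<in> e'} - {e}" and "G = {e' \<in> K. v \<in> e'} - {e}"
  define R where "R = K - insert e (F \<union> G)"
  define a where "a = n - 1"
  define N where "N = n choose 2"
  have eK: "e \<in> K" using uv by (auto simp: e_def K_def complete_edges_def)
  have only_e: "e' = e" if "e' \<in> K" "u \<in> e'" "v \<in> e'" for e'
    using that uv by (auto simp: K_def e_def complete_edges_def card_2_iff)
  have finK: "finite K" "card K = N" by (auto simp: K_def N_def card_complete_edges)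
  have fin: "finite F" "finite G" "finite R" using finK by (auto simp: F_def G_def R_def)
  have disj: "F \<inter> G = {}" "F \<inter> (G \<union> R) = {}" "G \<inter> R = {}" "e \<notin> F" "e \<notin> G" "e \<notin> R"
    using only_e by (auto simp: F_def G_def R_def)
  have star: "{e' \<in> K. u \<in> e'} = insert e F" "{e' \<in> K. v \<in> e'} = insert e G"
    using eK by (auto simp: F_def G_def e_def)
  have cF: "card F = a - 1" "card G = a - 1"
    using card_star[OF uv(1)] card_star[OF uv(2)] fin disj(4,5) star
    unfolding K_def[symmetric] a_def by auto
  have an: "a \<ge> 1" "j < a" using j by (auto simp: a_def)
  have un: "K = insert e (F \<union> (G \<union> R))" using eK by (auto simp: R_def F_def G_def)
  have cR: "card R = N - (2 * a - 1)"
  proof -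
    have "N = Suc (card F + (card G + card R))"
      unfolding finK(2)[symmetric] un using disj fin by (simp add: card_Un_disjoint)
    then show ?thesis using cF an by simp
  qed
  define D where "D = (\<lambda>S. vertex_degree S u = j \<and> vertex_degree S v = j)"
  have deg: "vertex_degree S u = card (S \<inter> insert e F)" "vertex_degree S v = card (S \<inter> insert e G)" if "S \<subseteq> K" for S
    unfolding vertex_degree_def star[symmetric] using that by (auto intro!: arg_cong[of _ _ card])
  have mN: "m \<le> N" using m by (simp add: N_def)
  have "perm_avg K (\<lambda>es. of_bool (D (set (take m es)))) \<le>
    perm_avg K (\<lambda>es. of_bool (D (set (take m es)) \<and> e \<notin> set (take m es)) +
       of_bool (card (set (take m es) \<inter> insert e (F \<union> G)) \<le> 2 * j - 1))"
  proof (rule perm_avg_mono)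
    fix es assume es: "es \<in> permutations_of_set K"
    define S where "S = set (take m es)"
    have S: "S \<subseteq> K" "finite S" using edge_orderD(4) es by (auto simp: S_def K_def)
    have "card (S \<inter> insert e (F \<union> G)) \<le> 2 * j - 1" if "D S" "e \<in> S"
    proof -
      have "card (S \<inter> F) = j - 1" "card (S \<inter> G) = j - 1"
        using that deg[OF S(1)] disj(4,5) S(2) by (auto simp: D_def)
      moreover have "S \<inter> insert e (F \<union> G) = insert e ((S \<inter> F) \<union> (S \<inter> G))" using that by auto
      moreover have "card ((S \<inter> F) \<union> (S \<inter> G)) \<le> card (S \<inter> F) + card (S \<inter> G)" by (rule card_Un_le)
      ultimately show ?thesis using S(2) disj(4,5) j by simp
    qed
    then show "of_bool (D (set (take m es))) \<le> (of_bool (D (set (take m es)) \<and> e \<notin> set (take m es)) +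
       of_bool (card (set (take m es) \<inter> insert e (F \<union> G)) \<le> 2 * j - 1) :: real)"
      unfolding S_def[symmetric] by auto
  qed
  also have "\<dots> = perm_avg K (\<lambda>es. of_bool (D (set (take m es)) \<and> e \<notin> set (take m es))) +
     perm_avg K (\<lambda>es. of_bool (card (set (take m es) \<inter> insert e (F \<union> G)) \<le> 2 * j - 1))"
    by (rule perm_avg_add)
  also have "perm_avg K (\<lambda>es. of_bool (D (set (take m es)) \<and> e \<notin> set (take m es)))
     = card {S. S \<subseteq> K \<and> card S = m \<and> D S \<and> e \<notin> S} / (N choose m)"
    using prefix_prob[of K m "\<lambda>S. D S \<and> e \<notin> S"] finK mN by simp
  also have "{S. S \<subseteq> K \<and> card S = m \<and> D S \<and> e \<notin> S} =
     {S. S \<subseteq> F \<union> (G \<union> R) \<and> card S = m \<and> card (S \<inter> F) = j \<and> card (S \<inter> (G \<union> R) \<inter> G) = j}"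
  proof (rule Collect_cong)
    fix S
    have "S \<inter> (G \<union> R) \<inter> G = S \<inter> G" by auto
    moreover have "D S \<longleftrightarrow> card (S \<inter> F) = j \<and> card (S \<inter> G) = j" if "S \<subseteq> K" "e \<notin> S"
      using deg[OF that(1)] that(2) by (auto simp: D_def)
    moreover have "S \<subseteq> K \<and> e \<notin> S \<longleftrightarrow> S \<subseteq> F \<union> (G \<union> R)"
      unfolding un using disj by auto
    ultimately show "(S \<subseteq> K \<and> card S = m \<and> D S \<and> e \<notin> S) \<longleftrightarrow>
        (S \<subseteq> F \<union> (G \<union> R) \<and> card S = m \<and> card (S \<inter> F) = j \<and> card (S \<inter> (G \<union> R) \<inter> G) = j)"
      by metis
  qed
  \<comment> \<open>The star of u is split off, and the condition on the star of v is carried along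
    as \<open>Q\<close> until it is split off from the remainder.\<close>
  also have "card \<dots> = (card F choose j) * card {S. S \<subseteq> G \<union> R \<and> card S = m - j \<and> card (S \<inter> G) = j}"
    using card_subsets_split[OF fin(1) _ disj(2), of j m "\<lambda>S. card (S \<inter> G) = j"] fin m by simp
  also have "card {S. S \<subseteq> G \<union> R \<and> card S = m - j \<and> card (S \<inter> G) = j} =
     (card G choose j) * card {S. S \<subseteq> R \<and> card S = m - j - j}"
    using card_subsets_split[OF fin(2,3) disj(3), of j "m - j" "\<lambda>_. True"] m by simp
  also have "card {S. S \<subseteq> R \<and> card S = m - j - j} = (N - (2 * a - 1)) choose (m - 2 * j)"
    using n_subsets[OF fin(3), of "m - j - j"] cR by (simp add: mult_2)
  also have "real ((card F choose j) * ((card G choose j) * (N - (2 * a - 1) choose (m - 2 * j)))) / (N choose m)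
     \<le> correlation N a m j * (degree_prob N a m j)\<^sup>2"
    unfolding cF using m an by (intro joint_degree_le) (auto simp: N_def a_def)
  also have "perm_avg K (\<lambda>es. of_bool (card (set (take m es) \<inter> insert e (F \<union> G)) \<le> 2 * j - 1))
     \<le> (1 / z) ^ (2 * j - 1) * (1 - (1 - z) * real (2 * (a - j)) / real N) ^ m"
  proof -
    have c: "card (insert e (F \<union> G)) = 2 * a - 1"
      using disj fin cF an by (simp add: card_Un_disjoint)
    have "2 * a - 1 - (2 * j - 1) = 2 * (a - j)" using an j by simp
    moreover have "insert e (F \<union> G) \<subseteq> K" using un by auto
    ultimately show ?thesis
      using prefix_hits_le[OF finK(1) _ z, of "insert e (F \<union> G)" "2 * j - 1" m] mN an
      unfolding c finK(2) by simp
  qed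
  finally show ?thesis by (simp add: K_def D_def N_def a_def)
qed

text \<open>Chebyshev's inequality for the number \<open>Z\<close> of vertices of degree exactly
  \<open>j\<close>: if all degrees exceed \<open>j\<close>, then \<open>Z = 0\<close> and
  \<open>(Z - \<mu>)\<^sup>2 / \<mu>\<^sup>2\<close> equals 1.\<close>

lemma no_low_degree_bound:
  fixes z :: real
  assumes n: "n \<ge> 2" and m: "2 * j \<le> m" "j < m" "2 * (n - 1) + m < n choose 2"
    and j: "1 \<le> j" "j < n - 1" and z: "0 < z" "z \<le> 1"
  defines "\<mu> \<equiv> n * degree_prob (n choose 2) (n - 1) m j"
  assumes \<mu>: "0 < \<mu>"
  shows "perm_avg (complete_edges n) (\<lambda>es. of_bool (\<forall>v\<in>{1..n}. j < vertex_degree (set (take m es)) v))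
    \<le> 1 / \<mu> + (correlation (n choose 2) (n - 1) m j - 1) +
      (real n)\<^sup>2 * ((1 / z) ^ (2 * j - 1) * (1 - (1 - z) * real (2 * (n - 1 - j)) / real (n choose 2)) ^ m) / \<mu>\<^sup>2"
proof -
  define K where "K = complete_edges n"
  define p where "p = degree_prob (n choose 2) (n - 1) m j"
  define \<rho> where "\<rho> = correlation (n choose 2) (n - 1) m j"
  define w where "w = (1 / z) ^ (2 * j - 1) * (1 - (1 - z) * real (2 * (n - 1 - j)) / real (n choose 2)) ^ m"
  define D where "D = (\<lambda>v es. vertex_degree (set (take m es)) v = j)"
  define Z where "Z = (\<lambda>es. \<Sum>v\<in>{1..n}. of_bool (D v es) :: real)"
  have \<mu>p: "\<mu> = n * p" by (simp add: \<mu>_def p_def)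
  have finK: "finite K" by (simp add: K_def)
  have P1: "perm_avg K (\<lambda>es. of_bool (D v es)) = p" if "v \<in> {1..n}" for v
    unfolding K_def D_def p_def using that m by (intro prob_degree_eq) auto
  have EZ: "perm_avg K Z = \<mu>"
    unfolding Z_def perm_avg_sum using P1 by (simp add: \<mu>p)
  \<comment> \<open>The diagonal pairs will be charged this term too, so its sign matters. It bounds
    the probability for the pair 1, 2, which exists since \<open>n \<ge> 2\<close>.\<close>
  have rw: "0 \<le> \<rho> * p\<^sup>2 + w"
  proof -
    have "perm_avg K (\<lambda>es. of_bool (D 1 es \<and> D 2 es)) \<le> \<rho> * p\<^sup>2 + w"
      unfolding K_def D_def p_def \<rho>_def w_def using n m j z by (intro prob_degrees_eq) auto
    moreover have "perm_avg K (\<lambda>_. 0) \<le> perm_avg K (\<lambda>es. of_bool (D 1 es \<and> D 2 es))"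
      by (intro perm_avg_mono) auto
    ultimately show ?thesis using finK by (simp add: perm_avg_const)
  qed
  have EZ2: "perm_avg K (\<lambda>es. (Z es)\<^sup>2) \<le> \<mu> + (real n)\<^sup>2 * (\<rho> * p\<^sup>2 + w)"
  proof -
    have square: "(Z es)\<^sup>2 = (\<Sum>u\<in>{1..n}. \<Sum>v\<in>{1..n}. of_bool (D u es \<and> D v es))" for es
      unfolding Z_def power2_eq_square sum_product by (intro sum.cong refl) auto
    have "perm_avg K (\<lambda>es. (Z es)\<^sup>2) = (\<Sum>u\<in>{1..n}. \<Sum>v\<in>{1..n}. perm_avg K (\<lambda>es. of_bool (D u es \<and> D v es)))"
      unfolding square perm_avg_sum ..
    also have "\<dots> \<le> (\<Sum>u\<in>{1..n}. \<Sum>v\<in>{1..n}. (if u = v then p else 0) + (\<rho> * p\<^sup>2 + w))"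
    proof (intro sum_mono)
      fix u v assume uv: "u \<in> {1..n}" "v \<in> {1..n}"
      show "perm_avg K (\<lambda>es. of_bool (D u es \<and> D v es)) \<le> (if u = v then p else 0) + (\<rho> * p\<^sup>2 + w)"
      proof (cases "u = v")
        case True
        then show ?thesis using P1[OF uv(1)] rw by simp
      next
        case False
        have "perm_avg K (\<lambda>es. of_bool (D u es \<and> D v es)) \<le> \<rho> * p\<^sup>2 + w"
          unfolding K_def D_def p_def \<rho>_def w_def using uv False m j z by (intro prob_degrees_eq) auto
        then show ?thesis using False by simp
      qed
    qed
    also have "\<dots> = \<mu> + (real n)\<^sup>2 * (\<rho> * p\<^sup>2 + w)"
      by (simp add: sum.distrib \<mu>p power2_eq_square algebra_simps)
    finally show ?thesis .
  qed
  have "perm_avg K (\<lambda>es. of_bool (\<forall>v\<in>{1..n}. j < vertex_degree (set (take m es)) v))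
     \<le> perm_avg K (\<lambda>es. (1 / \<mu>\<^sup>2) * (((Z es)\<^sup>2 - (2 * \<mu>) * Z es) + \<mu>\<^sup>2))"
  proof (rule perm_avg_mono)
    fix es
    have "Z es = 0" if "\<forall>v\<in>{1..n}. j < vertex_degree (set (take m es)) v"
      unfolding Z_def D_def using that by (intro sum.neutral) auto
    moreover have "((Z es)\<^sup>2 - (2 * \<mu>) * Z es) + \<mu>\<^sup>2 = (Z es - \<mu>)\<^sup>2" by (simp add: power2_diff)
    ultimately show "of_bool (\<forall>v\<in>{1..n}. j < vertex_degree (set (take m es)) v)
       \<le> (1 / \<mu>\<^sup>2) * (((Z es)\<^sup>2 - (2 * \<mu>) * Z es) + \<mu>\<^sup>2)" using \<mu> by auto
  qed
  also have "\<dots> = (1 / \<mu>\<^sup>2) * ((perm_avg K (\<lambda>es. (Z es)\<^sup>2) - (2 * \<mu>) * \<mu>) + \<mu>\<^sup>2)"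
    unfolding perm_avg_cmult perm_avg_add perm_avg_diff EZ using finK by (simp add: perm_avg_const)
  also have "\<dots> \<le> (1 / \<mu>\<^sup>2) * ((\<mu> + (real n)\<^sup>2 * (\<rho> * p\<^sup>2 + w) - (2 * \<mu>) * \<mu>) + \<mu>\<^sup>2)"
    using EZ2 by (intro mult_left_mono) auto
  also have "\<dots> = (1 / \<mu>\<^sup>2) * (\<mu> + \<rho> * \<mu>\<^sup>2 + (real n)\<^sup>2 * w - \<mu>\<^sup>2)"
    by (simp add: \<mu>p power2_eq_square algebra_simps)
  also have "\<dots> = 1 / \<mu> + (\<rho> - 1) + (real n)\<^sup>2 * w / \<mu>\<^sup>2"
    using \<mu> by (simp add: field_simps power2_eq_square)
  finally show ?thesis by (simp add: K_def \<rho>_def w_def)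
qed

section \<open>Asymptotics\<close>

text \<open>Starting late lowers the expected window degree of a vertex by about 2 T / n, that is
  \<open>ln (ln n) / 4\<close>. The window argument can spare anything below
  \<open>ln (ln n) / 2\<close>, so every constant below 1/4 in place of 1/8 would be
  possible.\<close>

definition phase_len :: "nat \<Rightarrow> nat" where
  "phase_len n = nat \<lfloor>real n * ln (ln (real n)) / 8\<rfloor>"

text \<open>At \<open>early_time (k - 1) n\<close> the expected number of vertices of degree \<open>k - 1\<close> is of order
  \<open>sqrt (ln n)\<close>, while that of vertices with at most \<open>k - 2\<close> edges since time
  \<open>phase_len n\<close> is of order at most \<open>(ln n) powr (- 1 / 4)\<close>.\<close>

definition early_time :: "nat \<Rightarrow> nat \<Rightarrow> nat" where
  "early_time j n = nat \<lfloor>real n / 2 * (ln (real n) + (real j - 1 / 2) * ln (ln (real n)))\<rfloor>"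

lemma real_choose_two: "real (n choose 2) = real n * (real n - 1) / 2"
proof -
  have "2 * (n choose 2) = n * (n - 1)"
  proof -
    have "even (n * (n - 1))" by (cases n) auto
    then show ?thesis unfolding choose_two by (rule dvd_mult_div_cancel)
  qed
  then have "2 * real (n choose 2) = real n * real (n - 1)" by (metis of_nat_mult of_nat_numeral)
  then show ?thesis by (cases n) auto
qed

lemma floor_bounds:
  assumes "0 \<le> x"
  shows "real (nat \<lfloor>x\<rfloor>) \<le> x" "x - 1 \<le> real (nat \<lfloor>x\<rfloor>)"
  using assms by linarith+

lemma phase_len_bounds:
  "eventually (\<lambda>n. real (phase_len n) \<le> real n * ln (ln (real n)) / 8 \<and>
      real n * ln (ln (real n)) / 8 - 1 \<le> real (phase_len n)) sequentially"
proof -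
  have "eventually (\<lambda>n::nat. 0 \<le> real n * ln (ln (real n)) / 8) sequentially" by real_asymp
  then show ?thesis unfolding phase_len_def by eventually_elim (intro conjI floor_bounds)
qed

lemma early_time_bounds:
  assumes "j \<ge> 1"
  shows "eventually (\<lambda>n.
      real (early_time j n) \<le> real n / 2 * (ln (real n) + (real j - 1 / 2) * ln (ln (real n))) \<and>
      real n / 2 * (ln (real n) + (real j - 1 / 2) * ln (ln (real n))) - 1 \<le> real (early_time j n)) sequentially"
proof -
  have "eventually (\<lambda>n::nat. 1 \<le> ln (real n) \<and> 0 \<le> ln (ln (real n))) sequentially"
    by (intro eventually_conj; real_asymp)
  then show ?thesis
  proof eventually_elim
    case (elim n)
    have "0 \<le> real n / 2 * (ln (real n) + (real j - 1 / 2) * ln (ln (real n)))" using elim assms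
      by (intro mult_nonneg_nonneg add_nonneg_nonneg) auto
    then show ?case unfolding early_time_def by (intro conjI floor_bounds)
  qed
qed

lemma early_time_sandwich:
  assumes "j \<ge> 1"
  shows "eventually (\<lambda>n. real n * ln (real n) / 2 - 1 \<le> real (early_time j n) \<and>
     real (early_time j n) \<le> real j * real n * ln (real n)) sequentially"
proof -
  have "eventually (\<lambda>n::nat. 1 \<le> ln (real n) \<and> 0 \<le> ln (ln (real n)) \<and> ln (ln (real n)) \<le> ln (real n)) sequentially"
    by (intro eventually_conj; real_asymp)
  with early_time_bounds[OF assms] show ?thesis
  proof eventually_elim
    case (elim n)
    have j: "real j \<ge> 1" using assms by simp
    have "0 \<le> (real j - 1 / 2) * ln (ln (real n))" using elim j by simp
    then have "real n / 2 * ln (real n) \<le> real n / 2 * (ln (real n) + (real j - 1 / 2) * ln (ln (real n)))"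
      by (intro mult_left_mono) auto
    moreover have "real n / 2 * (ln (real n) + (real j - 1 / 2) * ln (ln (real n))) \<le> real n / 2 * (2 * real j * ln (real n))"
    proof (intro mult_left_mono)
      have "(real j - 1 / 2) * ln (ln (real n)) \<le> (real j - 1 / 2) * ln (real n)"
        using elim j by (intro mult_left_mono) auto
      moreover have "ln (real n) + (real j - 1 / 2) * ln (real n) \<le> 2 * real j * ln (real n)"
        using mult_right_mono[of "1 + (real j - 1 / 2)" "2 * real j" "ln (real n)"] elim j by (simp add: algebra_simps)
      ultimately show "ln (real n) + (real j - 1 / 2) * ln (ln (real n)) \<le> 2 * real j * ln (real n)" by linarith
    qed auto
    ultimately show ?case using elim by (auto simp: field_simps)
  qed
qed

section \<open>The error terms\<close>

lemma late_error_tendsto: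
  assumes "\<delta> > 0"
  shows "(\<lambda>n. 25 * real (phase_len n) / (\<delta> * real n)\<^sup>2) \<longlonglongrightarrow> 0"
proof (rule tendsto_sandwich)
  show "eventually (\<lambda>n. 0 \<le> 25 * real (phase_len n) / (\<delta> * real n)\<^sup>2) sequentially" by simp
  show "eventually (\<lambda>n. 25 * real (phase_len n) / (\<delta> * real n)\<^sup>2 \<le>
      25 * (real n * ln (ln (real n)) / 8) / (\<delta> * real n)\<^sup>2) sequentially"
    using phase_len_bounds by eventually_elim (intro divide_right_mono mult_left_mono, auto)
  show "(\<lambda>n. 25 * (real n * ln (ln (real n)) / 8) / (\<delta> * real n)\<^sup>2) \<longlonglongrightarrow> 0"
    using assms by real_asymp
qed simp

lemma power_le_exp:
  fixes x :: real
  assumes "0 \<le> x" "x \<le> 1"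
  shows "(1 - x) ^ t \<le> exp (- (x * real t))"
proof -
  have "(1 - x) ^ t \<le> exp (- x) ^ t"
    using assms exp_ge_add_one_self[of "- x"] by (intro power_mono) auto
  then show ?thesis by (simp add: exp_of_nat_mult[symmetric] mult.commute)
qed

text \<open>The factor \<open>2 ^ n * 2 ^ (k * n)\<close> is exponential in n, while the probability
  is at most \<open>exp\<close> of a negative constant times \<open>phase_len n\<close>, which is
  superlinear. The factor \<open>ln (ln n)\<close> grows slowly but suffices for every fixed
  \<epsilon>.\<close>

lemma sparse_error_tendsto:
  fixes \<epsilon> :: real
  assumes \<epsilon>: "0 < \<epsilon>" "\<epsilon> \<le> 1"
  defines "l \<equiv> \<lambda>n. nat \<lceil>\<epsilon> * real n\<rceil>"
  shows "(\<lambda>n. 2 ^ n * (2 ^ (k * n) * (1 - (1 / 2) * real ((l n choose 2) - k * n) / real (n choose 2)) ^ phase_len n)) \<longlonglongrightarrow> 0"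
    and "eventually (\<lambda>n. k * n \<le> l n choose 2) sequentially"
    and "l n \<le> n"
proof -
  have l: "\<epsilon> * real n \<le> real (l n)" for n unfolding l_def by linarith
  show ln: "l n \<le> n" for n
  proof -
    have "\<epsilon> * real n \<le> real n" using \<epsilon> by (simp add: mult_left_le_one_le)
    then show ?thesis unfolding l_def by linarith
  qed
  have choose_l: "eventually (\<lambda>n. \<epsilon> * real n * (\<epsilon> * real n - 1) / 2 \<le> real (l n choose 2)) sequentially"
  proof -
    have "eventually (\<lambda>n::nat. 1 \<le> \<epsilon> * real n) sequentially" using \<epsilon> by real_asymp
    then show ?thesis
    proof eventually_elim
      case (elim n)
      then show ?case unfolding real_choose_two using l[of n]
        by (intro divide_right_mono mult_mono) auto
    qed
  qed
  have "eventually (\<lambda>n::nat. real k * real n \<le> \<epsilon> * real n * (\<epsilon> * real n - 1) / 2) sequentially"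
    using \<epsilon> by real_asymp
  with choose_l show kn: "eventually (\<lambda>n. k * n \<le> l n choose 2) sequentially"
  proof eventually_elim
    case (elim n)
    then have "real (k * n) \<le> real (l n choose 2)" by simp
    then show ?case by (simp only: of_nat_le_iff)
  qed
  have "((\<lambda>n::nat. (1 / 2) * (\<epsilon> * real n * (\<epsilon> * real n - 1) / 2 - real k * real n) / (real n * (real n - 1) / 2)) \<longlongrightarrow> \<epsilon> * \<epsilon> / 2) sequentially"
    using \<epsilon> by real_asymp
  \<comment> \<open>The exponent per edge tends to half the share of vertex pairs inside the set;
    one quarter leaves room for the limit.\<close>
  moreover have "\<epsilon> * \<epsilon> / 2 > \<epsilon>\<^sup>2 / 4" using \<epsilon> by (simp add: power2_eq_square)
  ultimately have lim: "eventually (\<lambda>n::nat. \<epsilon>\<^sup>2 / 4 < (1 / 2) * (\<epsilon> * real n * (\<epsilon> * real n - 1) / 2 - real k * real n) / (real n * (real n - 1) / 2)) sequentially"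
    by (rule order_tendstoD(1))
  show "(\<lambda>n. 2 ^ n * (2 ^ (k * n) * (1 - (1 / 2) * real ((l n choose 2) - k * n) / real (n choose 2)) ^ phase_len n)) \<longlonglongrightarrow> 0"
  proof (rule tendsto_sandwich)
    have x: "0 \<le> (1 / 2) * real ((l n choose 2) - k * n) / real (n choose 2)"
      "(1 / 2) * real ((l n choose 2) - k * n) / real (n choose 2) \<le> 1" for n
    proof -
      have "l n choose 2 \<le> n choose 2" using ln by (rule binomial_right_mono)
      then have "real ((l n choose 2) - k * n) \<le> real (n choose 2)" by linarith
      then show "(1 / 2) * real ((l n choose 2) - k * n) / real (n choose 2) \<le> 1" by (simp add: divide_le_eq)
    qed simp
    show "eventually (\<lambda>n. 0 \<le> 2 ^ n * (2 ^ (k * n) * (1 - (1 / 2) * real ((l n choose 2) - k * n) / real (n choose 2)) ^ phase_len n)) sequentially"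
      using x(2) by (intro always_eventually allI mult_nonneg_nonneg zero_le_power) auto
    show "eventually (\<lambda>n. 2 ^ n * (2 ^ (k * n) * (1 - (1 / 2) * real ((l n choose 2) - k * n) / real (n choose 2)) ^ phase_len n)
       \<le> exp (real (k + 1) * real n - \<epsilon>\<^sup>2 / 4 * (real n * ln (ln (real n)) / 8 - 1))) sequentially"
      using phase_len_bounds choose_l kn lim eventually_gt_at_top[of 1]
    proof eventually_elim
      case (elim n)
      define y where "y = (1 / 2) * real ((l n choose 2) - k * n) / real (n choose 2)"
      have "\<epsilon>\<^sup>2 / 4 \<le> y"
      proof -
        have "(1 / 2) * (\<epsilon> * real n * (\<epsilon> * real n - 1) / 2 - real k * real n) / (real n * (real n - 1) / 2) \<le> y"
          unfolding y_def real_choose_two using elim by (intro divide_right_mono mult_left_mono) (auto simp: of_nat_diff)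
        then show ?thesis using elim by linarith
      qed
      then have "\<epsilon>\<^sup>2 / 4 * (real n * ln (ln (real n)) / 8 - 1) \<le> y * real (phase_len n)"
        using elim by (meson mult_mono order_trans mult_left_mono mult_right_mono of_nat_0_le_iff zero_le_divide_iff zero_le_numeral zero_le_power2)
      then have "(1 - y) ^ phase_len n \<le> exp (- (\<epsilon>\<^sup>2 / 4 * (real n * ln (ln (real n)) / 8 - 1)))"
        using power_le_exp[of y "phase_len n"] x[of n] unfolding y_def[symmetric] by (smt (verit) exp_le_cancel_iff)
      moreover have "(2 :: real) ^ n * 2 ^ (k * n) \<le> exp (real (k + 1) * real n)"
      proof -
        have "(2 :: real) \<le> exp 1" using exp_ge_add_one_self[of 1] by simp
        then have "(2 :: real) ^ ((k + 1) * n) \<le> exp 1 ^ ((k + 1) * n)" by (intro power_mono) auto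
        also have "\<dots> = exp (real (k + 1) * real n)" by (simp add: exp_of_nat_mult[symmetric] algebra_simps)
        finally show ?thesis by (simp add: power_add)
      qed
      ultimately have "(2 ^ n * 2 ^ (k * n)) * (1 - y) ^ phase_len n \<le> exp (real (k + 1) * real n) * exp (- (\<epsilon>\<^sup>2 / 4 * (real n * ln (ln (real n)) / 8 - 1)))"
        using x(2)[of n] by (intro mult_mono) (auto simp: y_def)
      then show ?case unfolding y_def[symmetric] by (simp only: mult.assoc mult_exp_exp diff_conv_add_uminus)
    qed
    show "(\<lambda>n::nat. exp (real (k + 1) * real n - \<epsilon>\<^sup>2 / 4 * (real n * ln (ln (real n)) / 8 - 1))) \<longlonglongrightarrow> 0"
      using \<epsilon> by real_asymp
  qed simp
qed

lemma log_power_eq: "x > 1 \<Longrightarrow> ln x ^ i = exp (real i * ln (ln x))"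
  by (simp add: exp_of_nat_mult)

text \<open>The choice \<open>z = 1 / ln n\<close> yields exactly the power of \<open>ln n\<close>
  expected from the number of ways to have \<open>k - 2\<close> edges, while the factor
  \<open>1 - z\<close> costs only a bounded amount in an exponent of order
  \<open>ln n\<close>.\<close>

lemma window_error_tendsto:
  assumes k: "k \<ge> 2"
  shows "(\<lambda>n. real n * ((1 / (1 / ln (real n))) ^ (k - 2) *
     (1 - (1 - 1 / ln (real n)) * real (n - 1 - (k - 2)) / real (n choose 2)) ^ (early_time (k - 1) n - phase_len n))) \<longlonglongrightarrow> 0"
    (is "?f \<longlonglongrightarrow> 0")
proof (rule tendsto_sandwich)
  define i where "i = k - 2"
  have i: "k - 1 = Suc i" "k - 2 = i" using k by (auto simp: i_def)
  let ?q = "\<lambda>n. (1 - 1 / ln (real n)) * (real n - 1 - real i) / (real n * (real n - 1) / 2)"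
  let ?s = "\<lambda>n. real n / 2 * (ln (real n) + (real i + 1 / 2) * ln (ln (real n))) - 1 - real n * ln (ln (real n)) / 8"
  have ev: "eventually (\<lambda>n::nat. real i + 2 < real n \<and> 1 < ln (real n) \<and> 0 \<le> ?q n \<and> ?q n \<le> 1) sequentially"
    by (intro eventually_conj; real_asymp)
  have q: "(1 - 1 / ln (real n)) * real (n - 1 - (k - 2)) / real (n choose 2) = ?q n" if "real i + 2 < real n" for n
    using that unfolding real_choose_two i by (simp add: of_nat_diff)
  show "eventually (\<lambda>n. 0 \<le> ?f n) sequentially" using ev
  proof eventually_elim
    case (elim n)
    then show ?case using q[of n] by (intro mult_nonneg_nonneg zero_le_power) auto
  qed
  show "eventually (\<lambda>n. ?f n \<le> exp (ln (real n) + real i * ln (ln (real n)) - ?q n * ?s n)) sequentially"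
    using phase_len_bounds early_time_bounds[of "Suc i", OF le_add1[of 1 i, unfolded plus_1_eq_Suc]] ev eventually_gt_at_top[of 1] unfolding i
  proof eventually_elim
    case (elim n)
    have "real (Suc i) - 1 / 2 = real i + 1 / 2" by simp
    then have "?s n \<le> real (early_time (Suc i) n) - real (phase_len n)"
      using elim(1,2) by (simp only:) linarith
    also have "\<dots> \<le> real (early_time (Suc i) n - phase_len n)" by linarith
    finally have "?s n \<le> real (early_time (Suc i) n - phase_len n)" .
    then have "?q n * ?s n \<le> ?q n * real (early_time (Suc i) n - phase_len n)" using elim by (intro mult_left_mono) auto
    then have "(1 - ?q n) ^ (early_time (Suc i) n - phase_len n) \<le> exp (- (?q n * ?s n))"
      using power_le_exp[of "?q n" "early_time (Suc i) n - phase_len n"] elim by (smt (verit) exp_le_cancel_iff)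
    then have "real n * (ln (real n) ^ i * (1 - ?q n) ^ (early_time (Suc i) n - phase_len n)) \<le>
       real n * (ln (real n) ^ i * exp (- (?q n * ?s n)))"
      using elim by (intro mult_left_mono) auto
    also have "\<dots> = exp (ln (real n)) * (exp (real i * ln (ln (real n))) * exp (- (?q n * ?s n)))"
      using elim by (simp add: log_power_eq)
    also have "\<dots> = exp (ln (real n) + real i * ln (ln (real n)) - ?q n * ?s n)"
      by (simp only: exp_add[symmetric]) (simp add: algebra_simps)
    finally show ?case using q[of n] elim unfolding i by simp
  qed
  \<comment> \<open>The terms \<open>i * ln (ln n)\<close> cancel up to the vanishing
    \<open>(1 - ?A n) * ln (ln n)\<close>, which is split off. The remaining 1/4 is 1/2 from
    \<open>early_time\<close> less 1/4 from \<open>phase_len\<close>.\<close>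
  let ?A = "\<lambda>n. (1 - 1 / ln (real n)) * (real n - 1 - real i) / (real n - 1)"
  have "((\<lambda>n::nat. exp (ln (real n) - ?A n * (ln (real n) + ln (ln (real n)) / 4 - 2 / real n)) *
     exp (real i * ((1 - ?A n) * ln (ln (real n))))) \<longlongrightarrow> 0 * exp (real i * 0)) sequentially"
  proof (intro tendsto_mult tendsto_exp tendsto_const)
    show "(\<lambda>n::nat. exp (ln (real n) - ?A n * (ln (real n) + ln (ln (real n)) / 4 - 2 / real n))) \<longlonglongrightarrow> 0"
      by real_asymp
    show "(\<lambda>n::nat. (1 - ?A n) * ln (ln (real n))) \<longlonglongrightarrow> 0"
      by real_asymp
  qed
  then have "((\<lambda>n::nat. exp (ln (real n) - ?A n * (ln (real n) + ln (ln (real n)) / 4 - 2 / real n)) *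
     exp (real i * ((1 - ?A n) * ln (ln (real n))))) \<longlongrightarrow> 0) sequentially" by simp
  then show "(\<lambda>n::nat. exp (ln (real n) + real i * ln (ln (real n)) - ?q n * ?s n)) \<longlonglongrightarrow> 0"
  proof (rule Lim_transform_eventually)
    show "eventually (\<lambda>n::nat. exp (ln (real n) - ?A n * (ln (real n) + ln (ln (real n)) / 4 - 2 / real n)) *
       exp (real i * ((1 - ?A n) * ln (ln (real n)))) = exp (ln (real n) + real i * ln (ln (real n)) - ?q n * ?s n)) sequentially"
      using eventually_gt_at_top[of 1]
    proof eventually_elim
      case (elim n)
      have "?q n * ?s n = ?A n * (ln (real n) + (real i + 1 / 4) * ln (ln (real n)) - 2 / real n)"
        using elim by (simp add: divide_simps) (simp add: algebra_simps)
      moreover have "(x - y * (x + z / 4 - u)) + real i * ((1 - y) * z) = x + real i * z - y * (x + (real i + 1 / 4) * z - u)"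
        for x y z u :: real by (simp add: algebra_simps)
      ultimately show ?case by (simp only: mult_exp_exp)
    qed
  qed
qed simp

text \<open>Up to a constant the mean is at least \<open>n * ln n ^ j * exp (- 2 m / n)\<close>,
  with a vanishing correction in the exponent. The term \<open>j - 1 / 2\<close> in
  \<open>early_time\<close> makes this of order \<open>sqrt (ln n)\<close>.\<close>

lemma degree_prob_tendsto:
  assumes j: "j \<ge> 1"
  shows "filterlim (\<lambda>n. real n * degree_prob (n choose 2) (n - 1) (early_time j n) j) at_top sequentially"
proof (rule filterlim_at_top_mono)
  let ?M = "\<lambda>n. real n / 2 * (ln (real n) + (real j - 1 / 2) * ln (ln (real n)))"
  let ?N = "\<lambda>n. real n * (real n - 1) / 2"
  let ?h = "\<lambda>n. ln (real n) + real j * ln (ln (real n)) - (real n - 1) * ?M n / (?N n - ?M n - (real n - 1))"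
  have large: "eventually (\<lambda>n. 2 * (real n - 1) + ?M n < ?N n \<and> 1 < ln (real n) \<and> real j + 3 < real n \<and>
     real n * ln (real n) / 2 \<le> ?M n - 1 - real j) sequentially"
    using j by (intro eventually_conj; real_asymp)
  show "eventually (\<lambda>n. (1 / real j) ^ j * exp (?h n) \<le> real n * degree_prob (n choose 2) (n - 1) (early_time j n) j) sequentially"
    using early_time_bounds[OF j] large
  proof eventually_elim
    case (elim n)
    define m a N where "m = early_time j n" and "a = n - 1" and "N = n choose 2"
    define r where "r = (\<Prod>i<a - j. (real N - real m - real i) / (real N - real i))"
    have m: "real m \<le> ?M n" "?M n - 1 \<le> real m" using elim by (auto simp: m_def)
    have N: "real N = ?N n" by (simp add: N_def real_choose_two)
    have a: "real a = real n - 1" using elim by (simp add: a_def of_nat_diff)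
    have jm2: "real n * ln (real n) / 2 \<le> real m - real j" using m(2) elim(2) by linarith
    have "0 \<le> real n * ln (real n) / 2" using elim by simp
    then have "j \<le> m" using jm2 by linarith
    note jm = this jm2
    have ja: "j \<le> a" using elim(2) unfolding a_def by linarith
    have "2 * real a + real m < real N" using m elim unfolding N a by linarith
    then have am: "2 * a + m < N" by linarith
    have "real n * ((real a / real j) ^ j * (exp (- ((real n - 1) * ?M n / (?N n - ?M n - (real n - 1)))) * ((real m - real j) / real N) ^ j))
        \<le> real n * degree_prob N a m j"
    proof -
      have "exp (- ((real n - 1) * ?M n / (?N n - ?M n - (real n - 1)))) \<le> r"
      proof -
        define x where "x = real m / (real N - real m - real a)"
        have x0: "0 \<le> x" using am by (simp add: x_def)
        have "exp (- x) \<le> (real N - real m - real i) / (real N - real i)" if "i < a - j" for i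
        proof -
          \<comment> \<open>With this \<open>x\<close>, the smallest avoidance factor is exactly
            \<open>1 / (1 + x)\<close>.\<close>
          have "exp (- x) \<le> 1 / (1 + x)"
            using x0 exp_ge_add_one_self[of x] by (simp add: exp_minus field_simps)
          also have "\<dots> = (real N - real m - real a) / (real N - real a)"
            using am by (simp add: x_def field_simps)
          also have "\<dots> = 1 - real m / (real N - real a)" using am by (simp add: field_simps)
          also have "\<dots> \<le> 1 - real m / (real N - real i)"
            using that am by (intro diff_left_mono divide_left_mono) auto
          also have "\<dots> = (real N - real m - real i) / (real N - real i)" using that am by (simp add: field_simps)
          finally show ?thesis .
        qed
        then have "(\<Prod>i<a - j. exp (- x)) \<le> r" unfolding r_def by (intro prod_mono) auto
        then have "exp (- (real (a - j) * x)) \<le> r" by (simp add: exp_of_nat_mult[symmetric])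
        moreover have "real (a - j) * x \<le> (real n - 1) * ?M n / (?N n - ?M n - (real n - 1))"
        proof -
          have "real (a - j) * x \<le> real a * x" using x0 by (intro mult_right_mono) auto
          also have "\<dots> \<le> real a * (?M n / (?N n - ?M n - (real n - 1)))"
            unfolding x_def N a using m elim by (intro mult_left_mono frac_le) auto
          finally show ?thesis by (simp add: a)
        qed
        ultimately show ?thesis by (smt (verit) exp_le_cancel_iff)
      qed
      moreover have "0 < r" unfolding r_def using am by (intro avoid_prod_pos) auto
      moreover have "(real a / real j) ^ j \<le> real (a choose j)" using ja by (rule binomial_ge_n_over_k_pow_k)
      ultimately have "(real a / real j) ^ j * (exp (- ((real n - 1) * ?M n / (?N n - ?M n - (real n - 1)))) * ((real m - real j) / real N) ^ j)
         \<le> real (a choose j) * (r * ((real m - real j) / real N) ^ j)"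
        using jm by (intro mult_mono) auto
      also have "\<dots> \<le> degree_prob N a m j" unfolding r_def by (rule degree_prob_lower[OF jm(1) ja am])
      finally show ?thesis by (intro mult_left_mono) auto
    qed
    moreover have "(1 / real j) ^ j * ln (real n) ^ j \<le> (real a / real j) ^ j * ((real m - real j) / real N) ^ j"
    proof -
      have "ln (real n) / real j = real a / real j * ((real n * ln (real n) / 2) / real N)"
      proof -
        have "x / c = y / c * ((u * x / 2) / (u * y / 2))" if "u \<noteq> 0" "y \<noteq> 0" for x y c u :: real
          using that by simp
        then show ?thesis unfolding N a using elim(2) by auto
      qed
      also have "\<dots> \<le> real a / real j * ((real m - real j) / real N)"
        using jm by (intro mult_left_mono divide_right_mono) auto
      finally have "(ln (real n) / real j) ^ j \<le> (real a / real j * ((real m - real j) / real N)) ^ j"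
        using elim by (intro power_mono) auto
      then show ?thesis by (simp add: power_mult_distrib power_divide)
    qed
    then have "real n * exp (- ((real n - 1) * ?M n / (?N n - ?M n - (real n - 1)))) * ((1 / real j) ^ j * ln (real n) ^ j) \<le>
       real n * exp (- ((real n - 1) * ?M n / (?N n - ?M n - (real n - 1)))) * ((real a / real j) ^ j * ((real m - real j) / real N) ^ j)"
      by (intro mult_left_mono) auto
    moreover have "(1 / real j) ^ j * exp (?h n) =
        real n * exp (- ((real n - 1) * ?M n / (?N n - ?M n - (real n - 1)))) * ((1 / real j) ^ j * ln (real n) ^ j)"
    proof -
      have "exp (x + y - z) = exp x * (exp y * exp (- z))" for x y z :: real
        by (simp add: mult_exp_exp)
      moreover have "exp (ln (real n)) = real n" "exp (real j * ln (ln (real n))) = ln (real n) ^ j"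
        using elim(2) by (simp_all add: log_power_eq)
      ultimately have "exp (?h n) = real n * (ln (real n) ^ j * exp (- ((real n - 1) * ?M n / (?N n - ?M n - (real n - 1)))))"
        by (simp only:)
      then show ?thesis by (simp only: mult_ac)
    qed
    ultimately show ?case unfolding m_def a_def N_def by (simp only: mult_ac)
  qed
  have "filterlim ?h at_top sequentially" by real_asymp
  then have "filterlim (\<lambda>n. exp (?h n)) at_top sequentially" by (rule filterlim_compose[OF exp_at_top])
  then show "filterlim (\<lambda>n. (1 / real j) ^ j * exp (?h n)) at_top sequentially"
    using j by (intro filterlim_tendsto_pos_mult_at_top[OF tendsto_const]) auto
qed

lemma correlation_tendsto:
  assumes j: "j \<ge> 1"
  shows "(\<lambda>n. correlation (n choose 2) (n - 1) (early_time j n) j) \<longlonglongrightarrow> 1"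
proof -
  let ?N = "\<lambda>n. real n * (real n - 1) / 2"
  have mN: "(\<lambda>n. real (early_time j n) / ?N n) \<longlonglongrightarrow> 0"
  proof (rule tendsto_sandwich)
    show "eventually (\<lambda>n. 0 \<le> real (early_time j n) / ?N n) sequentially"
      using eventually_gt_at_top[of 1] by eventually_elim simp
    show "eventually (\<lambda>n. real (early_time j n) / ?N n \<le> real j * real n * ln (real n) / ?N n) sequentially"
      using early_time_sandwich[OF j] eventually_gt_at_top[of 1] by eventually_elim (intro divide_right_mono, auto)
    show "(\<lambda>n. real j * real n * ln (real n) / ?N n) \<longlonglongrightarrow> 0" by real_asymp
  qed simp
  have aN: "(\<lambda>n. (real n - 1) / ?N n) \<longlonglongrightarrow> 0" by real_asymp
  have "filterlim (\<lambda>n::nat. real n * ln (real n) / 2 - 1) at_top sequentially" by real_asymp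
  then have m_inf: "filterlim (\<lambda>n. real (early_time j n)) at_top sequentially"
    by (rule filterlim_at_top_mono) (use early_time_sandwich[OF j] in \<open>eventually_elim, auto\<close>)
  have jm: "(\<lambda>n. real j / real (early_time j n)) \<longlonglongrightarrow> 0"
    by (rule tendsto_divide_0[OF tendsto_const filterlim_at_top_imp_at_infinity[OF m_inf]])
  have "(\<lambda>n. 1 / (1 - real (early_time j n) / ?N n - (real n - 1) / ?N n) *
      (1 / ((1 - real j / real (early_time j n)) * (1 - 2 * ((real n - 1) / ?N n)))) ^ (2 * j))
      \<longlonglongrightarrow> 1 / (1 - 0 - 0) * (1 / ((1 - 0) * (1 - 2 * 0))) ^ (2 * j)"
    by (intro tendsto_intros mN aN jm) auto
  then have "(\<lambda>n. 1 / (1 - real (early_time j n) / ?N n - (real n - 1) / ?N n) *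
      (1 / ((1 - real j / real (early_time j n)) * (1 - 2 * ((real n - 1) / ?N n)))) ^ (2 * j)) \<longlonglongrightarrow> 1" by simp
  then show ?thesis
  proof (rule Lim_transform_eventually)
    have "eventually (\<lambda>n. real (early_time j n) > 0) sequentially"
      using m_inf unfolding filterlim_at_top_dense by blast
    then show "eventually (\<lambda>n. 1 / (1 - real (early_time j n) / ?N n - (real n - 1) / ?N n) *
      (1 / ((1 - real j / real (early_time j n)) * (1 - 2 * ((real n - 1) / ?N n)))) ^ (2 * j)
      = correlation (n choose 2) (n - 1) (early_time j n) j) sequentially"
      using eventually_gt_at_top[of 1]
    proof eventually_elim
      case (elim n)
      define m N a where "m = real (early_time j n)" and "N = ?N n" and "a = real n - 1"
      have N0: "N > 0" and m0: "m > 0" using elim by (auto simp: N_def m_def)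
      have "1 / (1 - m / N - a / N) = N / (N - m - a)"
      proof -
        have "1 - m / N - a / N = (N - m - a) / N" using N0 by (simp add: field_simps)
        then show ?thesis by simp
      qed
      moreover have "1 / ((1 - real j / m) * (1 - 2 * (a / N))) = m * N / ((m - real j) * (N - 2 * a))"
      proof -
        have "1 - real j / m = (m - real j) / m" "1 - 2 * (a / N) = (N - 2 * a) / N" using m0 N0 by (auto simp: field_simps)
        then show ?thesis by simp
      qed
      moreover have "real (n - 1) = a" using elim by (simp add: a_def of_nat_diff)
      ultimately show ?case
        unfolding correlation_def real_choose_two m_def N_def a_def by (simp only:)
    qed
  qed
qed

text \<open>Boundedness is enough, as the term is later divided by the square of a mean tending to
  infinity. The exponent tends to 2, the loss from \<open>1 - 1 / ln n\<close> against
  \<open>2 * ln n\<close>; 3 is any larger number.\<close>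

lemma pair_error_bounded:
  assumes j: "j \<ge> 1"
  shows "eventually (\<lambda>n. (real n)\<^sup>2 * ((1 / (1 / ln (real n))) ^ (2 * j - 1) *
     (1 - (1 - 1 / ln (real n)) * real (2 * (n - 1 - j)) / real (n choose 2)) ^ early_time j n) \<le> exp 3) sequentially"
proof -
  obtain i where i: "j = Suc i" using j by (cases j) auto
  have i': "2 * j - 1 = 2 * i + 1" by (simp add: i)
  let ?q = "\<lambda>n. (1 - 1 / ln (real n)) * (2 * (real n - 1 - real j)) / (real n * (real n - 1) / 2)"
  let ?s = "\<lambda>n. real n / 2 * (ln (real n) + (real i + 1 / 2) * ln (ln (real n))) - 1"
  let ?A = "\<lambda>n. (1 - 1 / ln (real n)) * (real n - 1 - real j) / (real n - 1)"
  have ev: "eventually (\<lambda>n::nat. real j + 2 < real n \<and> 1 < ln (real n) \<and> 0 \<le> ?q n \<and> ?q n \<le> 1) sequentially"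
    by (intro eventually_conj; real_asymp)
  have "(\<lambda>n::nat. 2 * ln (real n) + ln (ln (real n)) - ?A n * (2 * ln (real n) + ln (ln (real n)) - 4 / real n)
       + (2 * real i) * ((1 - ?A n) * ln (ln (real n)))) \<longlonglongrightarrow> 2 + (2 * real i) * 0"
  proof (intro tendsto_add tendsto_mult tendsto_const)
    show "(\<lambda>n::nat. 2 * ln (real n) + ln (ln (real n)) - ?A n * (2 * ln (real n) + ln (ln (real n)) - 4 / real n)) \<longlonglongrightarrow> 2"
      by real_asymp
    show "(\<lambda>n::nat. (1 - ?A n) * ln (ln (real n))) \<longlonglongrightarrow> 0"
      by real_asymp
  qed
  then have "eventually (\<lambda>n::nat. 2 * ln (real n) + ln (ln (real n)) - ?A n * (2 * ln (real n) + ln (ln (real n)) - 4 / real n)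
       + (2 * real i) * ((1 - ?A n) * ln (ln (real n))) < 3) sequentially"
    by (rule order_tendstoD) simp
  then show ?thesis using ev early_time_bounds[OF j] eventually_gt_at_top[of 1]
  proof eventually_elim
    case (elim n)
    have q: "(1 - 1 / ln (real n)) * real (2 * (n - 1 - j)) / real (n choose 2) = ?q n"
      using elim unfolding real_choose_two by (simp add: of_nat_diff)
    have "real j - 1 / 2 = real i + 1 / 2" by (simp add: i)
    then have "?s n \<le> real (early_time j n)" using elim(3) by (simp only:)
    then have "?q n * ?s n \<le> ?q n * real (early_time j n)" using elim by (intro mult_left_mono) auto
    then have "(1 - ?q n) ^ early_time j n \<le> exp (- (?q n * ?s n))"
      using power_le_exp[of "?q n" "early_time j n"] elim by (smt (verit) exp_le_cancel_iff)
    then have "(real n)\<^sup>2 * (ln (real n) ^ (2 * i + 1) * (1 - ?q n) ^ early_time j n) \<le>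
       (real n)\<^sup>2 * (ln (real n) ^ (2 * i + 1) * exp (- (?q n * ?s n)))"
      using elim by (intro mult_left_mono) auto
    also have "\<dots> = exp (2 * ln (real n) + (real (2 * i + 1) * ln (ln (real n)) + - (?q n * ?s n)))"
    proof -
      have "(real n)\<^sup>2 = exp (2 * ln (real n))" using elim by (simp add: exp_double)
      moreover have "ln (real n) ^ (2 * i + 1) = exp (real (2 * i + 1) * ln (ln (real n)))"
        using elim by (intro log_power_eq) simp
      ultimately show ?thesis by (simp only: exp_add)
    qed
    also have "\<dots> \<le> exp 3"
    proof -
      have "?q n * ?s n = ?A n * (2 * ln (real n) + (2 * real i + 1) * ln (ln (real n)) - 4 / real n)"
        using elim(4) by (simp add: divide_simps) (simp add: algebra_simps)
      moreover have "real (2 * i + 1) = 2 * real i + 1" by simp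
      moreover have "2 * x + ((2 * real i + 1) * z + - (y * (2 * x + (2 * real i + 1) * z - u))) =
         2 * x + z - y * (2 * x + z - u) + (2 * real i) * ((1 - y) * z)" for x y z u :: real
        by (simp add: algebra_simps)
      ultimately have "2 * ln (real n) + (real (2 * i + 1) * ln (ln (real n)) + - (?q n * ?s n)) =
        2 * ln (real n) + ln (ln (real n)) - ?A n * (2 * ln (real n) + ln (ln (real n)) - 4 / real n)
          + (2 * real i) * ((1 - ?A n) * ln (ln (real n)))" by (simp only:)
      then show ?thesis using elim(1) by simp
    qed
    finally show ?case unfolding q i' by simp
  qed
qed

lemma low_degree_error_tendsto:
  assumes j: "j \<ge> 1"
  defines "\<mu> \<equiv> \<lambda>n. real n * degree_prob (n choose 2) (n - 1) (early_time j n) j"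
  defines "w \<equiv> \<lambda>n. (real n)\<^sup>2 * ((1 / (1 / ln (real n))) ^ (2 * j - 1) *
     (1 - (1 - 1 / ln (real n)) * real (2 * (n - 1 - j)) / real (n choose 2)) ^ early_time j n)"
  shows "eventually (\<lambda>n. 1 / \<mu> n + (correlation (n choose 2) (n - 1) (early_time j n) j - 1) + w n / (\<mu> n)\<^sup>2
    \<le> 1 / \<mu> n + (correlation (n choose 2) (n - 1) (early_time j n) j - 1) + exp 3 / (\<mu> n)\<^sup>2) sequentially"
    and "(\<lambda>n. 1 / \<mu> n + (correlation (n choose 2) (n - 1) (early_time j n) j - 1) + exp 3 / (\<mu> n)\<^sup>2) \<longlonglongrightarrow> 0"
proof -
  have inf: "filterlim \<mu> at_infinity sequentially"
    unfolding \<mu>_def by (rule filterlim_at_top_imp_at_infinity[OF degree_prob_tendsto[OF j]])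
  have 1: "(\<lambda>n. 1 / \<mu> n) \<longlonglongrightarrow> 0"
    by (rule tendsto_divide_0[OF tendsto_const inf])
  have "(\<lambda>n. 1 / \<mu> n + (correlation (n choose 2) (n - 1) (early_time j n) j - 1) + exp 3 * (1 / \<mu> n)\<^sup>2) \<longlonglongrightarrow> 0 + (1 - 1) + exp 3 * 0\<^sup>2"
    by (intro tendsto_intros 1 correlation_tendsto j)
  then show "(\<lambda>n. 1 / \<mu> n + (correlation (n choose 2) (n - 1) (early_time j n) j - 1) + exp 3 / (\<mu> n)\<^sup>2) \<longlonglongrightarrow> 0"
    by (simp add: power_divide)
  show "eventually (\<lambda>n. 1 / \<mu> n + (correlation (n choose 2) (n - 1) (early_time j n) j - 1) + w n / (\<mu> n)\<^sup>2
    \<le> 1 / \<mu> n + (correlation (n choose 2) (n - 1) (early_time j n) j - 1) + exp 3 / (\<mu> n)\<^sup>2) sequentially"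
    using pair_error_bounded[OF j] unfolding w_def by eventually_elim (intro add_left_mono divide_right_mono, auto)
qed

section \<open>Success with high probability\<close>

lemma yielded_graph_prob:
  "measure_pmf.prob (yielded_graph n t (return_pmf \<sigma>)) X =
     perm_avg (complete_edges n) (\<lambda>es. of_bool (builder_graph \<sigma> es (t es) \<in> X))"
proof -
  have "measure_pmf.prob (yielded_graph n t (return_pmf \<sigma>)) X =
      measure_pmf.prob (edge_process n) {es. builder_graph \<sigma> es (t es) \<in> X}"
    by (simp add: yielded_graph_def pair_return_pmf1 pmf.map_comp o_def vimage_def)
  also have "\<dots> = card (permutations_of_set (complete_edges n) \<inter> {es. builder_graph \<sigma> es (t es) \<in> X}) /
      card (permutations_of_set (complete_edges n))"
    unfolding edge_process_def by (rule measure_pmf_of_set) (auto simp: permutations_of_set_empty_iff)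
  finally show ?thesis by (simp add: perm_avg_def)
qed

text \<open>The deterministic core: outside four exceptional events, the budget is never felt and
  every vertex ends up with \<open>k\<close> purchased edges.\<close>

lemma bought_succeeds:
  fixes \<delta> \<epsilon> :: real
  assumes es: "es \<in> permutations_of_set (complete_edges n)" and k: "k \<ge> 2" "k < n" and m: "T \<le> m"
    and late: "\<not> late_count k (take T es) > 2 * real n / 2 ^ k + \<delta> * n"
    and sparse: "\<not> (\<exists>L\<subseteq>{1..n}. nat \<lceil>\<epsilon> * n\<rceil> \<le> card L \<and> card {e \<in> set (take T es). e \<subseteq> L} \<le> k * n)"
    and early: "\<not> (\<forall>v\<in>{1..n}. k - 1 < vertex_degree (set (take m es)) v)"
    and window: "\<not> (\<exists>v\<in>{1..n}. vertex_degree (set (take (m - T) (drop T es))) v \<le> k - 2)"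
    and \<epsilon>: "2 * k * \<epsilon> \<le> \<delta>"
  shows "k \<le> min_degree n (builder_graph (budget_rule k T ((k / 2 + 1 / 2 ^ k + \<delta>) * n)) es (hitting_time n k es))"
proof -
  define \<tau> where "\<tau> = hitting_time n k es"
  have k1: "k \<ge> 1" using k by simp
  note hit = hitting_time_props[OF es k(2), folded \<tau>_def]
  have "m < \<tau>" using early hit(3)[of _ m] k by force
  then have T\<tau>: "T \<le> \<tau>" "m \<le> \<tau>" using m by auto
  define L where "L = deficient n k (bought k T es T)"
  have "card {e \<in> set (take T es). e \<subseteq> L} \<le> k * n"
    unfolding L_def using es T\<tau> hit(1) by (intro deficient_edges) auto
  moreover have "L \<subseteq> {1..n}" by (auto simp: L_def deficient_def)
  ultimately have "card L < nat \<lceil>\<epsilon> * n\<rceil>" using sparse by (meson not_le)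
  then have L: "real (card L) \<le> \<epsilon> * n" by linarith
  have "2 * card (bought k T es \<tau>) \<le> k * n + late_count k (take T es) + 2 * k * card L"
    unfolding L_def using es k1 T\<tau> hit(1) by (intro card_bought_le) auto
  then have "real (2 * card (bought k T es \<tau>)) \<le> real (k * n + late_count k (take T es) + 2 * k * card L)"
    by (simp only: of_nat_le_iff)
  also have "\<dots> \<le> real k * n + (2 * real n / 2 ^ k + \<delta> * n) + 2 * real k * (\<epsilon> * n)"
  proof -
    have "2 * real k * card L \<le> 2 * real k * (\<epsilon> * n)" using L by (intro mult_left_mono) auto
    then show ?thesis using late by simp
  qed
  also have "\<dots> \<le> real k * n + (2 * real n / 2 ^ k + \<delta> * n) + \<delta> * n"
    using mult_right_mono[OF \<epsilon>, of "real n"] by (simp add: mult.assoc)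
  \<comment> \<open>One \<delta> n comes from the deviation of the late count and one from the
    deficient vertices; halving leaves \<delta> n in the budget.\<close>
  also have "\<dots> = 2 * ((k / 2 + 1 / 2 ^ k + \<delta>) * n)" by (simp add: algebra_simps)
  finally have "real (card (bought k T es \<tau>)) \<le> (k / 2 + 1 / 2 ^ k + \<delta>) * n" by simp
  then have "builder_graph (budget_rule k T ((k / 2 + 1 / 2 ^ k + \<delta>) * n)) es \<tau> = bought k T es \<tau>"
    using hit(1) by (intro builder_graph_budget_rule_eq_bought) auto
  moreover have "k \<le> vertex_degree (bought k T es \<tau>) v" if v: "v \<in> {1..n}" for v
  proof (rule bought_min_degree[OF es k1 m T\<tau>(2) hit(1) hit(2)[OF v]])
    have "k - 2 < vertex_degree (set (take (m - T) (drop T es))) v" using window v by force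
    then show "k \<le> Suc (vertex_degree (set (take (m - T) (drop T es))) v)" by simp
  qed
  ultimately show ?thesis using k by (simp add: min_degree_ge_iff flip: \<tau>_def)
qed

theorem theorem1p1:
  fixes k :: nat and \<delta> :: real
  assumes "k \<ge> 2" and "\<delta> > 0"
  shows "\<exists>S :: nat \<Rightarrow> strategy.
    (\<forall>n. is_strategy n (hitting_time n k) ((real k / 2 + 1 / 2 ^ k + \<delta>) * real n) (S n)) \<and>
    (\<lambda>n. measure_pmf.prob (yielded_graph n (hitting_time n k) (S n)) {B. min_degree n B \<ge> k})
      \<longlonglongrightarrow> 1"
proof -
  \<comment> \<open>The quotient keeps the cost of deficient vertices within \<delta> n, and the
    minimum with 1 keeps the set size \<open>l n\<close> at most \<open>n\<close>.\<close>
  define \<epsilon> where "\<epsilon> = min 1 (\<delta> / (2 * k))"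
  define b where "b = (\<lambda>n. (real k / 2 + 1 / 2 ^ k + \<delta>) * real n)"
  define \<sigma> where "\<sigma> = (\<lambda>n. budget_rule k (phase_len n) (b n))"
  define m where "m = early_time (k - 1)"
  define z where "z = (\<lambda>n. 1 / ln (real n))"
  define l where "l = (\<lambda>n. nat \<lceil>\<epsilon> * real n\<rceil>)"
  define \<mu> where "\<mu> = (\<lambda>n. real n * degree_prob (n choose 2) (n - 1) (m n) (k - 1))"
  define P where "P = (\<lambda>n. measure_pmf.prob (yielded_graph n (hitting_time n k) (return_pmf (\<sigma> n))) {B. min_degree n B \<ge> k})"
  have \<epsilon>: "0 < \<epsilon>" "\<epsilon> \<le> 1" "2 * real k * \<epsilon> \<le> \<delta>"
    using assms by (auto simp: \<epsilon>_def min_def field_simps)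
  have k1: "k - 1 \<ge> 1" using assms by simp
  define e1 where "e1 = (\<lambda>n. 25 * real (phase_len n) / (\<delta> * real n)\<^sup>2)"
  define e2 where "e2 = (\<lambda>n. 2 ^ n * (2 ^ (k * n) * (1 - (1 / 2) * real ((l n choose 2) - k * n) / real (n choose 2)) ^ phase_len n))"
  define e3 where "e3 = (\<lambda>n. 1 / \<mu> n + (correlation (n choose 2) (n - 1) (m n) (k - 1) - 1) + exp 3 / (\<mu> n)\<^sup>2)"
  define e4 where "e4 = (\<lambda>n. real n * ((1 / z n) ^ (k - 2) * (1 - (1 - z n) * real (n - 1 - (k - 2)) / real (n choose 2)) ^ (m n - phase_len n)))"
  have "(\<lambda>n. 1 - (e1 n + (e2 n + (e3 n + e4 n)))) \<longlonglongrightarrow> 1 - (0 + (0 + (0 + 0)))"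
    unfolding e1_def e2_def e3_def e4_def \<mu>_def m_def z_def l_def
    by (intro tendsto_diff tendsto_add tendsto_const late_error_tendsto sparse_error_tendsto \<epsilon>
        low_degree_error_tendsto(2) window_error_tendsto assms k1)
  then have lim: "(\<lambda>n. 1 - (e1 n + (e2 n + (e3 n + e4 n)))) \<longlonglongrightarrow> 1" by simp
  have side: "eventually (\<lambda>n. phase_len n \<le> m n \<and> phase_len n < n choose 2 \<and> m n \<le> n choose 2 \<and>
     2 * (n - 1) + m n < n choose 2 \<and> 2 * (k - 1) \<le> m n \<and> k - 1 < m n) sequentially"
  proof -
    have "eventually (\<lambda>n. real n * ln (ln (real n)) / 8 \<le> real n * ln (real n) / 2 - 1 \<and>
      2 * real n + real (k - 1) * real n * ln (real n) < real n * (real n - 1) / 2 \<and>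
      2 * real k + 1 \<le> real n * ln (real n) / 2 - 1) sequentially"
      by (intro eventually_conj; real_asymp)
    with early_time_sandwich[OF k1] phase_len_bounds show ?thesis
    proof eventually_elim
      case (elim n)
      have "2 * real n + real (m n) < real (n choose 2)" "real (phase_len n) \<le> real (m n)" "2 * real k + 1 \<le> real (m n)"
        unfolding real_choose_two m_def using elim by linarith+
      then show ?case by linarith
    qed
  qed
  have "eventually (\<lambda>n. 1 \<le> ln (real n)) sequentially" by real_asymp
  moreover have "eventually (\<lambda>n. 0 < \<mu> n) sequentially"
    using degree_prob_tendsto[OF k1] unfolding \<mu>_def m_def filterlim_at_top_dense by blast
  ultimately have lower: "eventually (\<lambda>n. 1 - (e1 n + (e2 n + (e3 n + e4 n))) \<le> P n) sequentially"
    using side sparse_error_tendsto(2)[OF \<epsilon>(1,2), of k] low_degree_error_tendsto(1)[OF k1] eventually_gt_at_top[of k]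
  proof eventually_elim
    case (elim n)
    define T where "T = phase_len n"
    define K where "K = complete_edges n"
    have "k < n" using elim by auto
    then have n: "n \<ge> 2" "k - 2 \<le> n - 1" "k - 1 < n - 1" using assms by linarith+
    have side: "phase_len n \<le> m n" "phase_len n < n choose 2" "m n \<le> n choose 2"
      "2 * (n - 1) + m n < n choose 2" "2 * (k - 1) \<le> m n" "k - 1 < m n" "0 < \<mu> n"
      "k * n \<le> l n choose 2" "phase_len n \<le> n choose 2"
      using elim by (auto simp: l_def)
    have z: "0 < z n" "z n \<le> 1" using elim(1) n(1) by (auto simp: z_def divide_le_eq)
    define F1 where "F1 = (\<lambda>es. late_count k (take T es) > 2 * real n / 2 ^ k + \<delta> * n)"
    define F2 where "F2 = (\<lambda>es. \<exists>L\<subseteq>{1..n}. l n \<le> card L \<and> card {e \<in> set (take T es). e \<subseteq> L} \<le> k * n)"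
    define F3 where "F3 = (\<lambda>es. \<forall>v\<in>{1..n}. k - 1 < vertex_degree (set (take (m n) es)) v)"
    define F4 where "F4 = (\<lambda>es. \<exists>v\<in>{1..n}. vertex_degree (set (take (m n - T) (drop T es))) v \<le> k - 2)"
    have F1: "perm_avg K (\<lambda>es. of_bool (F1 es)) \<le> e1 n"
      using late_count_upper_tail[OF n(1), of k T "\<delta> * n"] assms side(9) n(1) unfolding K_def F1_def e1_def T_def by auto
    have F2: "perm_avg K (\<lambda>es. of_bool (F2 es)) \<le> e2 n"
      unfolding K_def F2_def e2_def T_def
      by (intro sparse_subset_bound side) (unfold l_def, rule sparse_error_tendsto(3)[OF \<epsilon>(1,2)])
    have F3: "perm_avg K (\<lambda>es. of_bool (F3 es)) \<le> e3 n"
    proof -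
      have "perm_avg K (\<lambda>es. of_bool (F3 es)) \<le> 1 / \<mu> n + (correlation (n choose 2) (n - 1) (m n) (k - 1) - 1) +
         (real n)\<^sup>2 * ((1 / z n) ^ (2 * (k - 1) - 1) * (1 - (1 - z n) * real (2 * (n - 1 - (k - 1))) / real (n choose 2)) ^ m n) / (\<mu> n)\<^sup>2"
        unfolding K_def F3_def \<mu>_def using side(7) by (intro no_low_degree_bound side n z k1) (simp add: \<mu>_def)
      also have "\<dots> \<le> e3 n" unfolding e3_def \<mu>_def m_def z_def by (rule elim(5))
      finally show ?thesis .
    qed
    have F4: "perm_avg K (\<lambda>es. of_bool (F4 es)) \<le> e4 n"
      unfolding K_def F4_def e4_def T_def by (intro window_degree_bound side n z)
    have "perm_avg K (\<lambda>es. 1 - (of_bool (F1 es) + (of_bool (F2 es) + (of_bool (F3 es) + of_bool (F4 es))))) \<le> P n"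
      unfolding P_def yielded_graph_prob K_def[symmetric]
    proof (rule perm_avg_mono)
      fix es assume es: "es \<in> permutations_of_set K"
      have "k \<le> min_degree n (builder_graph (\<sigma> n) es (hitting_time n k es))"
        if "\<not> F1 es" "\<not> F2 es" "\<not> F3 es" "\<not> F4 es"
        using that es \<open>k < n\<close> side(1) assms \<epsilon>(3) unfolding F1_def F2_def F3_def F4_def T_def \<sigma>_def b_def l_def K_def
        by (intro bought_succeeds[where m = "m n" and \<epsilon> = \<epsilon>]) auto
      then show "1 - (of_bool (F1 es) + (of_bool (F2 es) + (of_bool (F3 es) + of_bool (F4 es))))
        \<le> (of_bool (builder_graph (\<sigma> n) es (hitting_time n k es) \<in> {B. k \<le> min_degree n B}) :: real)"
        \<comment> \<open>Union bound: the left-hand side is positive only if none of the four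
          events occurs.\<close>
        by (cases "F1 es"; cases "F2 es"; cases "F3 es"; cases "F4 es") auto
    qed
    then show ?case using F1 F2 F3 F4 by (simp add: perm_avg_diff perm_avg_add perm_avg_const K_def)
  qed
  have "P \<longlonglongrightarrow> 1"
    by (rule tendsto_sandwich[OF lower _ lim tendsto_const]) (simp add: P_def)
  moreover have "is_strategy n (hitting_time n k) (b n) (return_pmf (\<sigma> n))" for n
    using assms by (auto simp: is_strategy_def \<sigma>_def b_def intro!: card_builder_graph_budget_rule)
  ultimately show ?thesis unfolding P_def b_def by (intro exI[of _ "\<lambda>n. return_pmf (\<sigma> n)"]) auto
qed

end
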